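(* There are absolute constants $C_0,C_1>0$ such that the following holds. Let $(X,\Pi)$ be a $d$-dimensional two-sided $\gamma$-local-spectral expander with $\gamma\le2^{-C_0k}$, and let $M$ be a complete $k$-dimensional HD-walk on $(X,\Pi)$ with $k<d$. Then for all $0\le i\le k$ and $\tau\in X(i)$, \[\phi(X_\tau)\in 1-\lambda_i(M)\pm c\gamma,\] where $c\le w(M)h(M)^22^{C_1k}$ and $X_\tau$ denotes the set of $k$-faces containing $\tau$.
   Context: Weighted pure simplicial complex $(X,\Pi)$ of dimension $d$: $X(d)\subseteq\binom{[n]}{d}$, $X(i)$ the $i$-subsets of members of $X(d)$, $\Pi_d=\Pi$ a distribution on $X(d)$, $\Pi_i(x)=\frac1{i+1}\sum_{y\in X(i+1),y\supset x}\Pi_{i+1}(y)$. Link of $s\in X(i)$: $\{t\setminus s:t\in X,t\supseteq s\}$ with induced distribution. Two-sided $\gamma$-local-spectral expander: for all $0\le i\le d-2$, $s\in X(i)$, the weighted graph on the $1$-faces of the link of $s$ with edges its $2$-faces has all nontrivial random-walk eigenvalues of absolute value $\le\gamma$. $C_k$: functions $X(k)\to\mathbb R$ with $\langle f,g\rangle=\mathbb E_{\Pi_k}[fg]$. $U_kf(y)=\frac1{k+1}\sum_{x\subset y}f(x)$; $D_{k+1}f(x)=\frac1{k+1}\sum_{y\supset x}\frac{\Pi_{k+1}(y)}{\Pi_k(x)}f(y)$. A $k$-dimensional pure walk is $Y=Z_{2h}\circ\cdots\circ Z_1:C_k\to C_k$ ($Z_1$ first), each $Z_i$ an up or down operator,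 with $h=h(Y)$ down operators at positions $i_1\le\dots\le i_h$; $\lambda_\ell(Y)=\prod_{s=1}^h\big(1-\frac{\ell}{\max\{\ell,i_s-2s+k+1\}}\big)$. A $k$-dimensional HD-walk is an affine combination $M=\sum_Y\alpha_YY$ ($\sum\alpha_Y=1$) of pure walks that is self-adjoint w.r.t. $\langle\cdot,\cdot\rangle$ and has nonnegative transition probabilities $M(s,t)$ (where $(Mf)(s)=\sum_tM(s,t)f(t)$); $h(M)=\max\{h(Y):\alpha_Y\neq0\}$, $w(M)=\sum|\alpha_Y|$, $\lambda_\ell(M)=\sum_Y\alpha_Y\lambda_\ell(Y)$. $M$ is complete if for every $n$ there are $n_0>n$ and $d'$ such that $\sum_Y\alpha_YY$ is also an HD-walk over the complete complex $J(n_0,d')$ (all $d'$-subsets of $[n_0]$, uniform distribution). For $S\subseteq X(k)$, the expansion is $\phi(S)=\mathbb E_{v\sim\Pi_k|_S}\big[\sum_{y\in X(k)\setminus S}M(v,y)\big]$. *)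

theory Defs
  imports Complex_Main
begin

text \<open>
  Faces are indexed by cardinality, so the vertices are the \<open>1\<close>-faces and the empty set is
  the only \<open>0\<close>-face. A weighted pure complex is given by its facets together with a weight
  on each facet; values of the weight outside the facets are irrelevant.
\<close>

record wcomplex =
  nverts :: nat
  cdim :: nat
  facets :: "nat set set"
  wt :: "nat set \<Rightarrow> real"

text \<open>
  The facet distribution has full support, so that every face has positive weight, as is
  needed for the down operators and the restriction of the weights to a set of faces to make
  sense.
\<close>

definition weighted_complex :: "wcomplex \<Rightarrow> bool" where
  "weighted_complex K \<longleftrightarrow>
     facets K \<subseteq> {t. t \<subseteq> {1..nverts K} \<and> card t = cdim K} \<and>
     (\<forall>t\<in>facets K. 0 < wt K t) \<and> (\<Sum>t\<in>facets K. wt K t) = 1"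

definition faces :: "wcomplex \<Rightarrow> nat \<Rightarrow> nat set set" where
  "faces K i = {s. card s = i \<and> (\<exists>t\<in>facets K. s \<subseteq> t)}"

function face_weight :: "wcomplex \<Rightarrow> nat \<Rightarrow> nat set \<Rightarrow> real" where
  "face_weight K i x =
     (if cdim K \<le> i then wt K x
      else 1 / real (i + 1) * (\<Sum>y\<in>{y \<in> faces K (i + 1). x \<subset> y}. face_weight K (i + 1) y))"
  by pat_completeness auto
termination
  by (relation "measure (\<lambda>(K, i, x). cdim K - i)") auto

declare face_weight.simps [simp del]

text \<open>
  The facet \<open>u = t - s\<close> of the link carries the weight of \<open>t = s \<union> u\<close>, conditioned on
  containing \<open>s\<close>.
\<close>

definition link :: "wcomplex \<Rightarrow> nat set \<Rightarrow> wcomplex" where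
  "link K s = \<lparr>nverts = nverts K, cdim = cdim K - card s,
     facets = {t - s | t. t \<in> facets K \<and> s \<subseteq> t},
     wt = (\<lambda>u. wt K (s \<union> u) / (\<Sum>t\<in>{t \<in> facets K. s \<subseteq> t}. wt K t))\<rparr>"

definition vertices :: "wcomplex \<Rightarrow> nat set" where
  "vertices K = {v. {v} \<in> faces K 1}"

definition graph_walk :: "wcomplex \<Rightarrow> (nat \<Rightarrow> real) \<Rightarrow> nat \<Rightarrow> real" where
  "graph_walk K f v =
     (\<Sum>u\<in>{u \<in> vertices K. {u, v} \<in> faces K 2}.
        face_weight K 2 {u, v} / (\<Sum>e\<in>{e \<in> faces K 2. v \<in> e}. face_weight K 2 e) * f u)"

text \<open>
  The trivial eigenvectors of the random walk are the constants, with eigenvalue \<open>1\<close>. An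
  eigenvalue is nontrivial if it has some nonconstant eigenvector; thus \<open>1\<close> itself is
  nontrivial exactly if it has multiplicity greater than one (the graph is disconnected).
  The walk is self-adjoint, so real eigenvalues and eigenvectors suffice.
\<close>

definition nontrivial_eigenvalue :: "wcomplex \<Rightarrow> real \<Rightarrow> bool" where
  "nontrivial_eigenvalue K \<mu> \<longleftrightarrow>
     (\<exists>f. (\<forall>v\<in>vertices K. graph_walk K f v = \<mu> * f v) \<and>
          \<not> (\<exists>c. \<forall>v\<in>vertices K. f v = c))"

definition two_sided_local_spectral_expander :: "real \<Rightarrow> wcomplex \<Rightarrow> bool" where
  "two_sided_local_spectral_expander \<gamma> K \<longleftrightarrow>
     (\<forall>i s. i + 2 \<le> cdim K \<longrightarrow> s \<in> faces K i \<longrightarrow>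
        (\<forall>\<mu>. nontrivial_eigenvalue (link K s) \<mu> \<longrightarrow> \<bar>\<mu>\<bar> \<le> \<gamma>))"

text \<open>
  An element of \<open>C\<^sub>k\<close> is represented by any function on sets of vertices; only its values on
  \<open>faces K k\<close> matter.
\<close>

definition inner_faces :: "wcomplex \<Rightarrow> nat \<Rightarrow> (nat set \<Rightarrow> real) \<Rightarrow> (nat set \<Rightarrow> real) \<Rightarrow> real" where
  "inner_faces K k f g = (\<Sum>x\<in>faces K k. face_weight K k x * (f x * g x))"

definition up :: "wcomplex \<Rightarrow> nat \<Rightarrow> (nat set \<Rightarrow> real) \<Rightarrow> nat set \<Rightarrow> real" where
  "up K k f y = 1 / real (k + 1) * (\<Sum>x\<in>{x \<in> faces K k. x \<subset> y}. f x)"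

text \<open>\<open>down K k\<close> is the operator \<open>D\<close> with index \<open>k + 1\<close>, from level \<open>k + 1\<close> to level \<open>k\<close>.\<close>

definition down :: "wcomplex \<Rightarrow> nat \<Rightarrow> (nat set \<Rightarrow> real) \<Rightarrow> nat set \<Rightarrow> real" where
  "down K k f x =
     1 / real (k + 1) *
     (\<Sum>y\<in>{y \<in> faces K (k + 1). x \<subset> y}. face_weight K (k + 1) y / face_weight K k x * f y)"

text \<open>
  A pure walk is the list of its steps in order of application (the head is \<open>Z\<^sub>1\<close>).
  \<open>walk_path d k j Y\<close> says that \<open>Y\<close>, started at level \<open>j\<close>, stays within the levels
  \<open>0, \<dots>, d\<close> and ends at level \<open>k\<close>.
\<close>

datatype step = Up | Down

fun walk_path :: "nat \<Rightarrow> nat \<Rightarrow> nat \<Rightarrow> step list \<Rightarrow> bool" where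
  "walk_path d k j [] \<longleftrightarrow> j = k"
| "walk_path d k j (Up # Y) \<longleftrightarrow> j < d \<and> walk_path d k (j + 1) Y"
| "walk_path d k j (Down # Y) \<longleftrightarrow> 0 < j \<and> walk_path d k (j - 1) Y"

definition pure_walk :: "nat \<Rightarrow> nat \<Rightarrow> step list \<Rightarrow> bool" where
  "pure_walk d k Y \<longleftrightarrow> k \<le> d \<and> walk_path d k k Y"

fun pure_walk_op ::
  "wcomplex \<Rightarrow> nat \<Rightarrow> step list \<Rightarrow> (nat set \<Rightarrow> real) \<Rightarrow> nat set \<Rightarrow> real" where
  "pure_walk_op K j [] f = f"
| "pure_walk_op K j (Up # Y) f = pure_walk_op K (j + 1) Y (up K j f)"
| "pure_walk_op K j (Down # Y) f = pure_walk_op K (j - 1) Y (down K (j - 1) f)"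

definition pure_height :: "step list \<Rightarrow> nat" where
  "pure_height Y = count_list Y Down"

definition down_positions :: "step list \<Rightarrow> nat list" where
  "down_positions Y = filter (\<lambda>j. Y ! (j - 1) = Down) [1..<length Y + 1]"

text \<open>
  List indexing starts at \<open>0\<close>, hence the \<open>s - 1\<close>. For a pure walk,
  \<open>i\<^sub>s - 2s + k + 1\<close> is the level from which the \<open>s\<close>-th down step starts, so it is at
  least \<open>1\<close> and the denominator never vanishes.
\<close>

definition pure_eigenvalue :: "nat \<Rightarrow> nat \<Rightarrow> step list \<Rightarrow> real" where
  "pure_eigenvalue k l Y =
     (\<Prod>s=1..pure_height Y.
        1 - real l / max (real l)
          (real (down_positions Y ! (s - 1)) - 2 * real s + real k + 1))"

text \<open>
  An affine combination of pure walks is given by its finitely supported coefficient function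
  \<open>\<alpha>\<close>. Its height, weight and approximate eigenvalues depend on the combination and not just
  on the resulting operator.
\<close>

definition walk_op ::
  "wcomplex \<Rightarrow> nat \<Rightarrow> (step list \<Rightarrow> real) \<Rightarrow> (nat set \<Rightarrow> real) \<Rightarrow> nat set \<Rightarrow> real" where
  "walk_op K k \<alpha> f s = (\<Sum>Y\<in>{Y. \<alpha> Y \<noteq> 0}. \<alpha> Y * pure_walk_op K k Y f s)"

definition transition ::
  "wcomplex \<Rightarrow> nat \<Rightarrow> (step list \<Rightarrow> real) \<Rightarrow> nat set \<Rightarrow> nat set \<Rightarrow> real" where
  "transition K k \<alpha> s t = walk_op K k \<alpha> (\<lambda>x. if x = t then 1 else 0) s"

definition hd_walk :: "wcomplex \<Rightarrow> nat \<Rightarrow> (step list \<Rightarrow> real) \<Rightarrow> bool" where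
  "hd_walk K k \<alpha> \<longleftrightarrow>
     finite {Y. \<alpha> Y \<noteq> 0} \<and>
     (\<forall>Y. \<alpha> Y \<noteq> 0 \<longrightarrow> pure_walk (cdim K) k Y) \<and>
     (\<Sum>Y\<in>{Y. \<alpha> Y \<noteq> 0}. \<alpha> Y) = 1 \<and>
     (\<forall>f g. inner_faces K k (walk_op K k \<alpha> f) g = inner_faces K k f (walk_op K k \<alpha> g)) \<and>
     (\<forall>s\<in>faces K k. \<forall>t\<in>faces K k. 0 \<le> transition K k \<alpha> s t)"

definition walk_height :: "(step list \<Rightarrow> real) \<Rightarrow> nat" where
  "walk_height \<alpha> = Max {pure_height Y | Y. \<alpha> Y \<noteq> 0}"

definition walk_weight :: "(step list \<Rightarrow> real) \<Rightarrow> real" where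
  "walk_weight \<alpha> = (\<Sum>Y\<in>{Y. \<alpha> Y \<noteq> 0}. \<bar>\<alpha> Y\<bar>)"

definition walk_eigenvalue :: "nat \<Rightarrow> nat \<Rightarrow> (step list \<Rightarrow> real) \<Rightarrow> real" where
  "walk_eigenvalue k l \<alpha> = (\<Sum>Y\<in>{Y. \<alpha> Y \<noteq> 0}. \<alpha> Y * pure_eigenvalue k l Y)"

definition complete_complex :: "nat \<Rightarrow> nat \<Rightarrow> wcomplex" where
  "complete_complex n d = \<lparr>nverts = n, cdim = d,
     facets = {t. t \<subseteq> {1..n} \<and> card t = d},
     wt = (\<lambda>t. 1 / real (n choose d))\<rparr>"

text \<open>The bound \<open>d \<le> n\<^sub>0\<close> ensures that the complete complex has facets at all.\<close>

definition complete_walk :: "nat \<Rightarrow> (step list \<Rightarrow> real) \<Rightarrow> bool" where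
  "complete_walk k \<alpha> \<longleftrightarrow>
     (\<forall>n. \<exists>n\<^sub>0>n. \<exists>d\<le>n\<^sub>0. hd_walk (complete_complex n\<^sub>0 d) k \<alpha>)"

definition expansion :: "wcomplex \<Rightarrow> nat \<Rightarrow> (step list \<Rightarrow> real) \<Rightarrow> nat set set \<Rightarrow> real" where
  "expansion K k \<alpha> S =
     (\<Sum>v\<in>S. face_weight K k v / (\<Sum>x\<in>S. face_weight K k x) *
        (\<Sum>y\<in>faces K k - S. transition K k \<alpha> v y))"

definition faces_containing :: "wcomplex \<Rightarrow> nat \<Rightarrow> nat set \<Rightarrow> nat set set" where
  "faces_containing K k \<tau> = {t \<in> faces K k. \<tau> \<subseteq> t}"

end

theory Submission
  imports Defs "HOL-Analysis.Analysis"
begin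

text \<open>
  Write \<open>g\<^sub>j\<close> for the indicator of the \<open>j\<close>-faces containing \<open>\<tau>\<close>, so that the expansion is
  \<open>1 - \<langle>g\<^sub>k, M g\<^sub>k\<rangle> / \<langle>g\<^sub>k, g\<^sub>k\<rangle>\<close>. An up step multiplies \<open>g\<^sub>j\<close> exactly by the factor
  \<open>1 - i / max {i, j + 1}\<close>, and a down step sends \<open>g\<^sub>j\<^sub>+\<^sub>1\<close> to \<open>g\<^sub>j + e\<^sub>j\<close>, where the excess \<open>e\<^sub>j\<close> is
  supported on faces that miss exactly one vertex of \<open>\<tau>\<close>, hence is orthogonal to \<open>g\<^sub>j\<close>. In a
  two-sided expander every vertex of a link has small weight, which gives
  \<open>\<parallel>e\<^sub>j\<parallel>\<^sup>2 \<le> 2 k \<gamma> \<parallel>g\<^sub>j\<^sub>+\<^sub>1\<parallel>\<^sup>2\<close>. By orthogonality the errors enter \<open>\<langle>g\<^sub>k, Y g\<^sub>k\<rangle>\<close> only in pairs, so for a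
  pure walk \<open>Y\<close> of height \<open>h\<close> this is \<open>\<lambda>\<^sub>i(Y) \<langle>g\<^sub>k, g\<^sub>k\<rangle>\<close> up to \<open>2 k \<gamma> h\<^sup>2 \<langle>g\<^sub>k, g\<^sub>k\<rangle>\<close>.
\<close>

section \<open>Operator norm of the walk on a loopless weighted graph\<close>

text \<open>The faces containing \<tau> may have tiny measure, so every error must be bounded
  relative to it. The excess at level j is measured against the norm of the indicator one level up,
  which can be far larger than the norm at level k; the factors of \<lambda>_i(Y) that belong to the
  steps still to come pay for this change of level. Tracked along the walk is the inner product of
  the current function with the indicator at its own level. As up and down are adjoint, a down step
  multiplies it exactly by a factor of \<lambda>_i(Y) while adding an excess to the error part, and
  an up step changes it only by pairing that error part with a new excess. Hence the quadratic
  count: up steps times down steps, which is h^2 for a closed walk. Vertex weights are small because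
  links have no loops: for the walk A on a link, <\<delta>_a, A \<delta>_a> = 0, while the constant
  component of \<delta>_a contributes the square of the weight of a, and the mean-zero part can
  cancel at most \<gamma> times that weight.\<close>

locale loopless_weighted_graph =
  fixes V :: "'a set" and w :: "'a \<Rightarrow> 'a \<Rightarrow> real"
  assumes finite_V: "finite V"
    and w_sym: "w x y = w y x"
    and w_loopless: "w x x = 0"
    and deg_pos: "x \<in> V \<Longrightarrow> 0 < (\<Sum>y\<in>V. w x y)"
    and deg_total: "(\<Sum>x\<in>V. \<Sum>y\<in>V. w x y) = 1"
begin

text \<open>Since the weights total 1, this is the stationary distribution of the walk, and
  \<open>ip\<close> is an expectation.\<close>

definition deg :: "'a \<Rightarrow> real" where
  "deg x = (\<Sum>y\<in>V. w x y)"

definition ip :: "('a \<Rightarrow> real) \<Rightarrow> ('a \<Rightarrow> real) \<Rightarrow> real" where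
  "ip f g = (\<Sum>x\<in>V. deg x * (f x * g x))"

definition walk :: "('a \<Rightarrow> real) \<Rightarrow> 'a \<Rightarrow> real" where
  "walk f x = (\<Sum>y\<in>V. w x y * f y) / deg x"

definition eigenvalue_bound :: "real \<Rightarrow> bool" where
  "eigenvalue_bound \<gamma> \<longleftrightarrow>
     (\<forall>\<mu> f. (\<forall>x\<in>V. walk f x = \<mu> * f x) \<longrightarrow> \<not> (\<exists>c. \<forall>x\<in>V. f x = c) \<longrightarrow> \<bar>\<mu>\<bar> \<le> \<gamma>)"

lemma deg_gt_0: "x \<in> V \<Longrightarrow> 0 < deg x"
  using deg_pos by (simp add: deg_def)

lemma sum_deg: "(\<Sum>x\<in>V. deg x) = 1"
  using deg_total by (simp add: deg_def)

lemma ip_commute: "ip f g = ip g f"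
  by (simp add: ip_def mult.commute)

lemma ip_add_left: "ip (\<lambda>x. f x + g x) h = ip f h + ip g h"
  by (simp add: ip_def algebra_simps sum.distrib)

lemma ip_scale_left: "ip (\<lambda>x. c * f x) h = c * ip f h"
  by (simp add: ip_def algebra_simps sum_distrib_left)

lemma ip_diff_left: "ip (\<lambda>x. f x - g x) h = ip f h - ip g h"
  by (simp add: ip_def algebra_simps sum_subtractf)

lemma ip_add_right: "ip h (\<lambda>x. f x + g x) = ip h f + ip h g"
  by (simp add: ip_def algebra_simps sum.distrib)

lemma ip_scale_right: "ip h (\<lambda>x. c * f x) = c * ip h f"
  by (simp add: ip_def algebra_simps sum_distrib_left)

lemma ip_diff_right: "ip h (\<lambda>x. f x - g x) = ip h f - ip h g"
  by (simp add: ip_def algebra_simps sum_subtractf)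

lemmas ip_linear = ip_add_left ip_scale_left ip_diff_left ip_add_right ip_scale_right ip_diff_right

lemma ip_cong: "(\<And>x. x \<in> V \<Longrightarrow> f x = f' x) \<Longrightarrow> (\<And>x. x \<in> V \<Longrightarrow> g x = g' x) \<Longrightarrow> ip f g = ip f' g'"
  by (simp add: ip_def)

lemma ip_self_nonneg: "0 \<le> ip f f"
  unfolding ip_def by (intro sum_nonneg) (simp add: deg_gt_0 less_imp_le)

lemma ip_self_eq_0D: "ip f f = 0 \<Longrightarrow> x \<in> V \<Longrightarrow> f x = 0"
  unfolding ip_def
  by (subst (asm) sum_nonneg_eq_0_iff)
     (use finite_V deg_gt_0 in \<open>force simp: less_imp_le\<close>)+

lemma walk_add: "walk (\<lambda>x. f x + g x) = (\<lambda>x. walk f x + walk g x)"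
  by (simp add: walk_def fun_eq_iff algebra_simps sum.distrib add_divide_distrib)

lemma walk_scale: "walk (\<lambda>x. c * f x) = (\<lambda>x. c * walk f x)"
  by (simp add: walk_def fun_eq_iff algebra_simps sum_distrib_left)

lemma walk_const: "x \<in> V \<Longrightarrow> walk (\<lambda>_. c) x = c"
  using deg_gt_0[of x] by (simp add: walk_def deg_def flip: sum_distrib_right)

lemma walk_cong: "(\<And>x. x \<in> V \<Longrightarrow> f x = g x) \<Longrightarrow> walk f = walk g"
  by (simp add: walk_def fun_eq_iff cong: sum.cong)

lemma walk_symmetric: "ip (walk f) g = ip f (walk g)"
proof -
  have deg_walk: "deg x * walk h x = (\<Sum>y\<in>V. w x y * h y)" if "x \<in> V" for x h
    using deg_gt_0[OF that] by (simp add: walk_def)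
  have "ip (walk f) g = (\<Sum>x\<in>V. (deg x * walk f x) * g x)"
    by (simp add: ip_def mult.assoc)
  also have "\<dots> = (\<Sum>x\<in>V. \<Sum>y\<in>V. w x y * f y * g x)"
    by (intro sum.cong refl) (simp add: deg_walk sum_distrib_right)
  also have "\<dots> = (\<Sum>y\<in>V. \<Sum>x\<in>V. w x y * f y * g x)"
    by (rule sum.swap)
  also have "\<dots> = (\<Sum>y\<in>V. (deg y * walk g y) * f y)"
  proof (intro sum.cong refl)
    fix y assume "y \<in> V"
    have "w x y * f y * g x = w y x * g x * f y" for x
      using w_sym[of x y] by simp
    then show "(\<Sum>x\<in>V. w x y * f y * g x) = (deg y * walk g y) * f y"
      using \<open>y \<in> V\<close> by (simp only: deg_walk sum_distrib_right)
  qed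
  also have "\<dots> = ip f (walk g)"
    by (simp add: ip_def mult_ac)
  finally show ?thesis .
qed

lemma ip_const_walk: "ip (\<lambda>_. 1) (walk f) = ip (\<lambda>_. 1) f"
  unfolding walk_symmetric[symmetric] by (rule ip_cong) (auto simp: walk_const)

section \<open>Existence of an extremal mean-zero function\<close>

lemma exists_mean_zero_unit: "\<exists>f. (\<forall>x. x \<notin> V \<longrightarrow> f x = 0) \<and> ip (\<lambda>_. 1) f = 0 \<and> ip f f = 1"
proof -
  have "V \<noteq> {}" using sum_deg by auto
  then obtain u where u: "u \<in> V" by auto
  \<comment> \<open>A vertex of positive degree has a partner with nonzero weight, distinct from it
    because there are no loops; two vertices suffice for a nonzero mean-zero function.\<close>
  have "\<exists>v\<in>V. w u v \<noteq> 0"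
    using deg_gt_0[OF u] by (auto simp: deg_def intro: ccontr)
  then obtain v where v: "v \<in> V" "v \<noteq> u" using w_loopless by metis
  define f where "f x = (if x = u then 1 / deg u else if x = v then - 1 / deg v else 0)" for x
  have "ip (\<lambda>_. 1) f = (\<Sum>x\<in>{u, v}. deg x * f x)"
    unfolding ip_def using u v finite_V
    by (intro sum.mono_neutral_cong_right) (auto simp: f_def)
  also have "\<dots> = 0" using v u deg_gt_0[OF u] deg_gt_0[OF v(1)] by (auto simp: f_def)
  finally have mean: "ip (\<lambda>_. 1) f = 0" .
  have "ip f f \<noteq> 0" using ip_self_eq_0D[of f u] u deg_gt_0[OF u] by (auto simp: f_def)
  then have pos: "ip f f > 0" using ip_self_nonneg[of f] by linarith
  define c where "c = 1 / sqrt (ip f f)"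
  define g where "g x = c * f x" for x
  have "c * c * ip f f = 1" using pos by (simp add: c_def)
  then have "ip g g = 1" by (simp add: g_def[abs_def] ip_linear)
  moreover have "ip (\<lambda>_. 1) g = 0" using mean by (simp add: g_def[abs_def] ip_linear)
  moreover have "\<forall>x. x \<notin> V \<longrightarrow> g x = 0" using u v by (auto simp: g_def f_def)
  ultimately show ?thesis by blast
qed

text \<open>Functions live on the whole type with the product topology. Demanding the value 0 off V
  places them in a product of intervals, compact by Tychonoff, in which the remaining equations are
  closed conditions.\<close>

lemma compact_mean_zero_unit:
  "compact {f. (\<forall>x. x \<notin> V \<longrightarrow> f x = 0) \<and> ip (\<lambda>_. 1) f = 0 \<and> ip f f = 1}" (is "compact ?S")
proof -
  \<comment> \<open>From deg x * (f x)^2 <= ip f f = 1; the interval {0} off V encodes the support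
    condition.\<close>
  define B where "B x = (if x \<in> V then 1 / sqrt (deg x) else 0)" for x
  have "compactin (product_topology (\<lambda>i. euclidean :: real topology) UNIV) (PiE UNIV (\<lambda>x. {- B x..B x}))"
    by (simp add: compactin_PiE)
  then have "compact (PiE UNIV (\<lambda>x. {- B x..B x}))"
    by (simp add: euclidean_product_topology)
  moreover have "closed {f. ip (\<lambda>_. 1) f = 0 \<and> ip f f = 1}"
    unfolding ip_def
    by (intro closed_Collect_conj closed_Collect_eq continuous_intros continuous_on_product_coordinates)
  ultimately have "compact (PiE UNIV (\<lambda>x. {- B x..B x}) \<inter> {f. ip (\<lambda>_. 1) f = 0 \<and> ip f f = 1})"
    by (rule compact_Int_closed)
  also have "PiE UNIV (\<lambda>x. {- B x..B x}) \<inter> {f. ip (\<lambda>_. 1) f = 0 \<and> ip f f = 1} = ?S"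
  proof -
    have "f x \<in> {- B x..B x}" if "ip f f = 1" "\<forall>x. x \<notin> V \<longrightarrow> f x = 0" for f x
    proof (cases "x \<in> V")
      case True
      have "deg x * (f x * f x) \<le> ip f f"
        unfolding ip_def
        by (rule member_le_sum[where f = "\<lambda>x. deg x * (f x * f x)"])
           (use True finite_V deg_gt_0 in \<open>auto simp: less_imp_le\<close>)
      then have "(f x)\<^sup>2 \<le> 1 / deg x"
        using that(1) deg_gt_0[OF True] by (simp add: field_simps power2_eq_square)
      then have "\<bar>f x\<bar> \<le> sqrt (1 / deg x)"
        by (metis real_sqrt_abs real_sqrt_le_iff)
      then show ?thesis using True by (auto simp: B_def real_sqrt_divide abs_le_iff)
    qed (use that(2) in \<open>auto simp: B_def\<close>)
    then have sub: "?S \<subseteq> PiE UNIV (\<lambda>x. {- B x..B x})"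
      unfolding PiE_UNIV_domain by blast
    have "f x = 0" if "f \<in> PiE UNIV (\<lambda>x. {- B x..B x})" "x \<notin> V" for f x
      using PiE_mem[OF that(1) UNIV_I[of x]] that(2) by (simp add: B_def)
    then show ?thesis using sub by blast
  qed
  finally show ?thesis .
qed

text \<open>Compactness gives a maximiser on the unit sphere; both sides scale quadratically and see
  only the values on V, so the bound extends to all mean-zero functions.\<close>

lemma rayleigh_maximizer:
  obtains f0 where "ip (\<lambda>_. 1) f0 = 0" "ip f0 f0 = 1"
    "\<And>f. ip (\<lambda>_. 1) f = 0 \<Longrightarrow> ip (walk f) (walk f) \<le> ip (walk f0) (walk f0) * ip f f"
proof -
  let ?S = "{f. (\<forall>x. x \<notin> V \<longrightarrow> f x = 0) \<and> ip (\<lambda>_. 1) f = 0 \<and> ip f f = 1}"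
  have "continuous_on ?S (\<lambda>f. ip (walk f) (walk f))"
    unfolding ip_def walk_def
    by (intro continuous_intros continuous_on_subset[OF continuous_on_product_coordinates])
       (auto dest: deg_gt_0)
  moreover have "?S \<noteq> {}" using exists_mean_zero_unit by blast
  ultimately have "\<exists>f0\<in>?S. \<forall>f\<in>?S. ip (walk f) (walk f) \<le> ip (walk f0) (walk f0)"
    by (intro continuous_attains_sup compact_mean_zero_unit)
  then obtain f0 where f0: "f0 \<in> ?S" "\<And>f. f \<in> ?S \<Longrightarrow> ip (walk f) (walk f) \<le> ip (walk f0) (walk f0)"
    by blast
  have "ip (walk f) (walk f) \<le> ip (walk f0) (walk f0) * ip f f" if mean: "ip (\<lambda>_. 1) f = 0" for f
  proof (cases "ip f f = 0")
    case True
    then have "walk f = walk (\<lambda>_. 0)" by (intro walk_cong) (auto dest: ip_self_eq_0D)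
    then show ?thesis using True by (simp add: walk_def ip_def)
  next
    case False
    then have pos: "ip f f > 0" using ip_self_nonneg[of f] by linarith
    define c where "c = 1 / sqrt (ip f f)"
    define g where "g x = (if x \<in> V then c * f x else 0)" for x
    have cc: "c * c * ip f f = 1" using pos by (simp add: c_def)
    have "ip g g = ip (\<lambda>x. c * f x) (\<lambda>x. c * f x)" by (rule ip_cong) (auto simp: g_def)
    then have "ip g g = 1" using cc by (simp add: ip_linear)
    moreover have "ip (\<lambda>_. 1) g = ip (\<lambda>_. 1) (\<lambda>x. c * f x)" by (rule ip_cong) (auto simp: g_def)
    ultimately have "g \<in> ?S" using mean by (auto simp: ip_linear g_def)
    then have *: "ip (walk g) (walk g) \<le> ip (walk f0) (walk f0)" by (rule f0(2))
    have "walk g = walk (\<lambda>x. c * f x)" by (rule walk_cong) (auto simp: g_def)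
    then have "ip (walk g) (walk g) = c * c * ip (walk f) (walk f)"
      by (simp add: walk_scale ip_linear)
    with * have "c * c * ip (walk f) (walk f) * ip f f \<le> ip (walk f0) (walk f0) * ip f f"
      using pos by simp
    moreover have "c * c * ip (walk f) (walk f) * ip f f = ip (walk f) (walk f)"
      using cc by (metis mult.assoc mult.commute mult.left_neutral)
    ultimately show ?thesis by simp
  qed
  then show ?thesis using that f0(1) by blast
qed

text \<open>
  Maximising \<open>\<parallel>A f\<parallel>\<close> rather than \<open>\<langle>f, A f\<rangle>\<close> over the unit sphere of the mean-zero functions
  bounds the operator norm at once: the maximiser satisfies \<open>A\<^sup>2 f = \<mu>\<^sup>2 f\<close>, so \<open>f\<close> or
  \<open>A f + \<mu> f\<close> is an eigenvector for \<open>-\<mu>\<close> or \<open>\<mu>\<close>.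
\<close>

lemma walk_norm_bound:
  assumes ev: "eigenvalue_bound \<gamma>"
  shows "0 \<le> \<gamma>" "ip (\<lambda>_. 1) f = 0 \<Longrightarrow> ip (walk f) (walk f) \<le> \<gamma>\<^sup>2 * ip f f"
proof -
  obtain f0 where f0: "ip (\<lambda>_. 1) f0 = 0" "ip f0 f0 = 1"
    and le: "\<And>f. ip (\<lambda>_. 1) f = 0 \<Longrightarrow> ip (walk f) (walk f) \<le> ip (walk f0) (walk f0) * ip f f"
    by (rule rayleigh_maximizer) blast
  define M where "M = ip (walk f0) (walk f0)"
  define \<mu> where "\<mu> = sqrt M"
  have M: "0 \<le> M" unfolding M_def by (rule ip_self_nonneg)
  have mumu: "\<mu> * \<mu> = M" using M by (simp add: \<mu>_def)
  define h where "h x = walk (walk f0) x - M * f0 x" for x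
  have h_mean: "ip (\<lambda>_. 1) h = 0"
    unfolding h_def[abs_def] using f0 by (simp add: ip_linear ip_const_walk)
  have hh: "ip h h = ip (walk f0) (walk h) - M * ip f0 h"
    by (subst h_def[abs_def]) (simp add: ip_linear walk_symmetric)
  \<comment> \<open>Maximality of f0, tested against f0 + t h where h is the residual of A^2 f0 = M
    f0. The linear term in t dominates near 0, so h must vanish.\<close>
  have "2 * t * ip h h + t\<^sup>2 * (ip (walk h) (walk h) - M * ip h h) \<le> 0" for t
  proof -
    have "ip (walk (\<lambda>x. f0 x + t * h x)) (walk (\<lambda>x. f0 x + t * h x))
       \<le> M * ip (\<lambda>x. f0 x + t * h x) (\<lambda>x. f0 x + t * h x)"
      unfolding M_def using f0 h_mean by (intro le) (simp add: ip_linear)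
    then have "M + 2 * t * ip (walk f0) (walk h) + t\<^sup>2 * ip (walk h) (walk h)
       \<le> M * (1 + 2 * t * ip f0 h + t\<^sup>2 * ip h h)"
      using f0 ip_commute[of h f0] ip_commute[of "walk h" "walk f0"]
      by (simp add: walk_add walk_scale ip_linear algebra_simps power2_eq_square flip: M_def)
    moreover have "ip (walk f0) (walk h) = ip h h + M * ip f0 h" using hh by simp
    ultimately show ?thesis by (simp add: algebra_simps)
  qed
  note quad = this
  have "ip h h = 0"
  proof (rule ccontr)
    assume "ip h h \<noteq> 0"
    then have pos: "ip h h > 0" using ip_self_nonneg[of h] by linarith
    define N where "N = ip (walk h) (walk h) - M * ip h h"
    \<comment> \<open>Small enough that the quadratic term is at most half the linear one.\<close>
    define t where "t = ip h h / (\<bar>N\<bar> + 1)"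
    have t: "t > 0" using pos by (simp add: t_def add_nonneg_pos)
    have "t * (2 * ip h h + t * N) \<le> 0"
      using quad[of t] by (simp add: N_def algebra_simps power2_eq_square)
    then have "2 * ip h h + t * N \<le> 0" using t by (simp add: mult_le_0_iff)
    moreover have "t * \<bar>N\<bar> \<le> ip h h"
      using pos by (simp add: t_def field_simps)
    moreover have "- (t * \<bar>N\<bar>) \<le> t * N" using t by (simp add: abs_if)
    ultimately show False using pos by linarith
  qed
  then have AA: "walk (walk f0) x = M * f0 x" if "x \<in> V" for x
    using ip_self_eq_0D[of h x] that by (simp add: h_def)
  \<comment> \<open>A constant function of mean zero is 0 on V, so every mean-zero eigenvector of
    nonzero norm is nontrivial.\<close>
  have nonconst: "\<not> (\<exists>c. \<forall>x\<in>V. f x = c)" if "ip (\<lambda>_. 1) f = 0" "ip f f \<noteq> 0" for f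
  proof
    assume "\<exists>c. \<forall>x\<in>V. f x = c"
    then obtain c where c: "\<forall>x\<in>V. f x = c" by blast
    then have "ip (\<lambda>_. 1) f = ip (\<lambda>_. 1) (\<lambda>_. c)" by (intro ip_cong) auto
    also have "\<dots> = c" using sum_deg by (simp add: ip_def flip: sum_distrib_right)
    finally have "c = 0" using that by simp
    then have "ip f f = ip (\<lambda>_. 0) (\<lambda>_. 0)" using c by (intro ip_cong) auto
    then show False using that by (simp add: ip_def)
  qed
  define g where "g x = walk f0 x + \<mu> * f0 x" for x
  have "\<mu> \<le> \<gamma>"
  proof (cases "ip g g = 0")
    case True
    then have "\<forall>x\<in>V. walk f0 x = (- \<mu>) * f0 x"
      using ip_self_eq_0D[of g] by (force simp: g_def)
    then have "\<bar>- \<mu>\<bar> \<le> \<gamma>" using ev[unfolded eigenvalue_bound_def, rule_format, of f0 "- \<mu>"] nonconst[of f0] f0 by simp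
    then show ?thesis by linarith
  next
    case False
    have "\<forall>x\<in>V. walk g x = \<mu> * g x"
      by (simp add: g_def[abs_def] walk_add walk_scale AA algebra_simps flip: mumu)
    moreover have "ip (\<lambda>_. 1) g = 0"
      unfolding g_def[abs_def] using f0 by (simp add: ip_linear ip_const_walk)
    ultimately have "\<bar>\<mu>\<bar> \<le> \<gamma>" using ev[unfolded eigenvalue_bound_def, rule_format] nonconst[of g] False by blast
    then show ?thesis by linarith
  qed
  moreover have "0 \<le> \<mu>" using M by (simp add: \<mu>_def)
  ultimately show "0 \<le> \<gamma>" by linarith
  have "M \<le> \<gamma>\<^sup>2" using \<open>\<mu> \<le> \<gamma>\<close> \<open>0 \<le> \<mu>\<close> mumu by (metis mult_mono' power2_eq_square)
  then show "ip (walk f) (walk f) \<le> \<gamma>\<^sup>2 * ip f f" if "ip (\<lambda>_. 1) f = 0"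
    using le[OF that] ip_self_nonneg[of f] mult_right_mono[of M "\<gamma>\<^sup>2" "ip f f"]
    unfolding M_def by linarith
qed

text \<open>Split the point mass \<delta> at a as deg a * 1 + g with g of mean zero. Without loops
  <\<delta>, A \<delta>> = 0, so (deg a)^2 = - <g, A g> <= \<gamma> <g, g> <= \<gamma> deg a. The
  same splitting gives |A \<delta>|^2 = (deg a)^2 + |A g|^2, at most (\<gamma> + \<gamma>^2) deg
  a.\<close>

lemma
  assumes ev: "eigenvalue_bound \<gamma>"
    and a: "a \<in> V"
  shows deg_le: "deg a \<le> \<gamma>"
    and sum_square_transition_le: "\<gamma> \<le> 1 \<Longrightarrow> (\<Sum>x\<in>V. deg x * (w x a / deg x)\<^sup>2) \<le> 2 * \<gamma> * deg a"
proof -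
  define \<delta> where "\<delta> x = (if x = a then 1 else 0 :: real)" for x
  define g where "g x = \<delta> x - deg a" for x
  have \<delta>_eq: "\<delta> = (\<lambda>x. deg a * 1 + g x)" by (simp add: g_def fun_eq_iff)
  have ip_\<delta>: "ip \<delta> f = deg a * f a" for f
    using a finite_V unfolding ip_def \<delta>_def
    by (subst sum.remove[of _ a]) (auto intro!: sum.neutral)
  have one: "ip (\<lambda>_. 1) (\<lambda>_. 1) = 1" using sum_deg by (simp add: ip_def)
  have 1: "ip (\<lambda>_. 1) g = 0"
  proof -
    have "ip (\<lambda>_. 1) g = ip (\<lambda>_. 1) \<delta> - deg a * ip (\<lambda>_. 1) (\<lambda>_. 1)"
      unfolding g_def[abs_def] ip_diff_right ip_scale_right[symmetric] by simp
    then show ?thesis using ip_\<delta>[of "\<lambda>_. 1"] one by (simp add: ip_commute)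
  qed
  have gg: "ip g g = deg a - (deg a)\<^sup>2"
  proof -
    have "ip \<delta> \<delta> = deg a * deg a + ip g g"
      unfolding \<delta>_eq using 1 one ip_commute[of g "\<lambda>_. 1"] by (simp only: ip_linear) simp
    then show ?thesis using ip_\<delta>[of \<delta>] by (simp add: \<delta>_def power2_eq_square)
  qed
  have walk\<delta>: "walk \<delta> x = w x a / deg x" for x
    unfolding walk_def \<delta>_def using a finite_V
    by (subst sum.remove[of _ a]) (auto intro!: sum.neutral)
  have walk\<delta>': "walk \<delta> x = deg a * 1 + walk g x" if "x \<in> V" for x
    unfolding \<delta>_eq walk_add walk_scale using walk_const[OF that] by simp
  note \<gamma> = walk_norm_bound[OF ev]
  have bound: "ip (walk g) (walk g) \<le> \<gamma>\<^sup>2 * ip g g" using \<gamma>(2)[OF 1] .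
  have \<gamma>0: "0 \<le> \<gamma>" using \<gamma>(1) .
  have gg0: "0 \<le> ip g g" by (rule ip_self_nonneg)
  have d0: "0 < deg a" using deg_gt_0[OF a] .
  have w1: "ip (\<lambda>_. 1) (walk g) = 0" using 1 by (simp add: ip_const_walk)
  show "deg a \<le> \<gamma>"
  proof -
    have "0 = ip \<delta> (walk \<delta>)" by (simp add: ip_\<delta> walk\<delta> w_loopless)
    also have "\<dots> = ip \<delta> (\<lambda>x. deg a * 1 + walk g x)" by (rule ip_cong) (auto simp: walk\<delta>')
    also have "\<dots> = deg a * deg a + ip g (walk g)"
      unfolding \<delta>_eq using 1 w1 one ip_commute[of g "\<lambda>_. 1"] by (simp only: ip_linear) simp
    finally have eq: "deg a * deg a = - ip g (walk g)" by simp
    \<comment> \<open>Nonnegativity of this square stands in for Cauchy-Schwarz without square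
      roots. The result is divided by \<gamma>, so \<gamma> = 0 needs its own case, in which A g = 0
      contradicts the absence of a loop at a.\<close>
    have "0 \<le> ip (\<lambda>x. walk g x + \<gamma> * g x) (\<lambda>x. walk g x + \<gamma> * g x)" by (rule ip_self_nonneg)
    also have "\<dots> = ip (walk g) (walk g) + 2 * \<gamma> * ip g (walk g) + \<gamma>\<^sup>2 * ip g g"
      using ip_commute[of g "walk g"] by (simp add: ip_linear power2_eq_square algebra_simps)
    also have "\<dots> \<le> 2 * \<gamma> * (\<gamma> * ip g g - deg a * deg a)"
      using bound eq by (simp add: algebra_simps power2_eq_square)
    finally have *: "0 \<le> \<gamma> * (\<gamma> * ip g g - deg a * deg a)" by simp
    have "deg a * deg a \<le> \<gamma> * ip g g"
    proof (cases "\<gamma> = 0")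
      case True
      then have "ip (walk g) (walk g) = 0" using bound ip_self_nonneg[of "walk g"] by simp
      then have "walk g a = 0" using a by (rule ip_self_eq_0D)
      then show ?thesis using walk\<delta>'[OF a] d0 by (simp add: walk\<delta> w_loopless)
    next
      case False
      then show ?thesis using * \<gamma>0 by (simp add: zero_le_mult_iff)
    qed
    also have "\<dots> \<le> \<gamma> * deg a" using \<gamma>0 by (intro mult_left_mono) (auto simp: gg)
    finally show ?thesis using d0 by simp
  qed
  assume "\<gamma> \<le> 1"
  have "(\<Sum>x\<in>V. deg x * (w x a / deg x)\<^sup>2) = ip (walk \<delta>) (walk \<delta>)"
    by (simp add: ip_def walk\<delta> power2_eq_square)
  also have "\<dots> = ip (\<lambda>x. deg a * 1 + walk g x) (\<lambda>x. deg a * 1 + walk g x)"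
    by (rule ip_cong) (auto simp: walk\<delta>')
  also have "\<dots> = deg a * deg a + ip (walk g) (walk g)"
    using w1 one ip_commute[of "walk g" "\<lambda>_. 1"] by (simp only: ip_linear) simp
  also have "\<dots> \<le> deg a * \<gamma> + \<gamma>\<^sup>2 * deg a"
  proof -
    have "\<gamma>\<^sup>2 * ip g g \<le> \<gamma>\<^sup>2 * deg a" by (intro mult_left_mono) (auto simp: gg)
    moreover have "deg a * deg a \<le> deg a * \<gamma>" using d0 \<open>deg a \<le> \<gamma>\<close> by simp
    ultimately show ?thesis using bound by linarith
  qed
  also have "\<dots> \<le> 2 * \<gamma> * deg a"
  proof -
    have "\<gamma>\<^sup>2 \<le> \<gamma> * 1" unfolding power2_eq_square using \<open>\<gamma> \<le> 1\<close> \<gamma>0 by (intro mult_left_mono) auto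
    then have "\<gamma>\<^sup>2 * deg a \<le> \<gamma> * deg a" using d0 by (intro mult_right_mono) auto
    then show ?thesis by (simp add: algebra_simps)
  qed
  finally show "(\<Sum>x\<in>V. deg x * (w x a / deg x)\<^sup>2) \<le> 2 * \<gamma> * deg a" .
qed

end

section \<open>Faces, weights and the up and down operators\<close>

text \<open>The vertices of the link of s. Faces one level above s are indexed by the added vertex,
  which turns sums over superfaces into sums over vertices.\<close>

definition ext :: "wcomplex \<Rightarrow> nat set \<Rightarrow> nat set" where
  "ext K s = {b. b \<notin> s \<and> insert b s \<in> faces K (Suc (card s))}"

text \<open>The probability that a random facet contains x. It carries no level and vanishes off the
  faces, so sums may be padded with non-faces.\<close>

definition mass :: "wcomplex \<Rightarrow> nat set \<Rightarrow> real" where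
  "mass K x = (\<Sum>t\<in>{t \<in> facets K. x \<subseteq> t}. wt K t)"

lemma Suc_times_choose_Suc:
  assumes "j < d"
  shows "real (Suc j) * real (d choose Suc j) = real (d - j) * real (d choose j)"
proof -
  have "Suc j * (d choose Suc j) = (d - j) * (d choose j)"
    using assms by (metis Suc_diff_1 Suc_times_binomial binomial_absorb_comp gr_implies_not0 not_gr0)
  then show ?thesis by (metis of_nat_mult)
qed

lemma card_faces: "x \<in> faces K j \<Longrightarrow> card x = j"
  by (simp add: faces_def)

context
  fixes K
  assumes wc: "weighted_complex K"
begin

lemma finite_facets: "finite (facets K)"
  using wc unfolding weighted_complex_def
  by (intro finite_subset[of "facets K" "Pow {1..nverts K}"]) auto

lemma facet_finite_card: "t \<in> facets K \<Longrightarrow> finite t \<and> card t = cdim K"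
  using wc unfolding weighted_complex_def by (auto intro: finite_subset)

lemma faces_subset_Pow: "faces K j \<subseteq> Pow {1..nverts K}"
  using wc unfolding weighted_complex_def faces_def by blast

lemma finite_faces: "finite (faces K j)"
  using faces_subset_Pow by (rule finite_subset) simp

lemma finite_face: "x \<in> faces K j \<Longrightarrow> finite x"
  using faces_subset_Pow by (meson PowD finite_atLeastAtMost finite_subset subsetD)

lemma faces_dim:
  assumes "x \<in> faces K j"
  shows "j \<le> cdim K"
proof -
  obtain t where "t \<in> facets K" "x \<subseteq> t" "card x = j"
    using assms by (auto simp: faces_def)
  then show ?thesis using facet_finite_card[of t] card_mono[of t x] by simp
qed

lemma faces_top: "faces K (cdim K) = facets K"
proof
  show "faces K (cdim K) \<subseteq> facets K"
  proof
    fix x assume "x \<in> faces K (cdim K)"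
    then obtain t where t: "t \<in> facets K" "x \<subseteq> t" "card x = cdim K"
      by (auto simp: faces_def)
    then show "x \<in> facets K" using facet_finite_card[of t] card_subset_eq[of t x] by simp
  qed
  show "facets K \<subseteq> faces K (cdim K)"
    using facet_finite_card by (auto simp: faces_def)
qed

lemma subface: "y \<in> faces K j \<Longrightarrow> x \<subseteq> y \<Longrightarrow> x \<in> faces K (card x)"
  unfolding faces_def by auto

lemma face_extend:
  assumes "x \<in> faces K j" "j < cdim K"
  shows "ext K x \<noteq> {}"
proof -
  obtain t where t: "t \<in> facets K" "x \<subseteq> t" "card x = j"
    using assms by (auto simp: faces_def)
  then have "x \<noteq> t" using assms facet_finite_card[of t] by auto
  then obtain v where v: "v \<in> t" "v \<notin> x" using t by blast
  have "finite x" using t facet_finite_card finite_subset by blast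
  then have "card (insert v x) = Suc j" using v t by simp
  then have "v \<in> ext K x" using v t by (auto simp: ext_def faces_def)
  then show ?thesis by blast
qed

lemma ext_subset: "ext K x \<subseteq> {1..nverts K}"
  unfolding ext_def using faces_subset_Pow by blast

lemma finite_ext: "finite (ext K x)"
  using ext_subset by (rule finite_subset) simp

lemma superfaces_eq:
  assumes "x \<in> faces K j"
  shows "{y \<in> faces K (Suc j). x \<subset> y} = (\<lambda>v. insert v x) ` ext K x"
proof -
  have "y \<in> (\<lambda>v. insert v x) ` ext K x" if y: "y \<in> faces K (Suc j)" "x \<subset> y" for y
  proof -
    obtain v where v: "v \<in> y" "v \<notin> x" using y by blast
    have "finite y" using y finite_face by blast
    then have "insert v x = y"
      using v y card_faces[OF y(1)] card_faces[OF assms] finite_face[OF assms]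
      by (intro card_subset_eq) auto
    then show ?thesis using v y card_faces[OF assms] by (auto simp: ext_def)
  qed
  then show ?thesis using card_faces[OF assms] by (auto simp: ext_def)
qed

lemma inj_on_insert_ext: "inj_on (\<lambda>v. insert v x) (ext K x)"
  by (auto simp: inj_on_def ext_def)

lemma subfaces_eq:
  assumes "y \<in> faces K (Suc j)"
  shows "{x \<in> faces K j. x \<subset> y} = (\<lambda>v. y - {v}) ` y"
proof -
  have fin: "finite y" and card: "card y = Suc j"
    using assms finite_face card_faces by auto
  have "x \<in> (\<lambda>v. y - {v}) ` y" if x: "x \<in> faces K j" "x \<subset> y" for x
  proof -
    obtain v where v: "v \<in> y" "v \<notin> x" using x by blast
    have "x = y - {v}"
      using v x fin card card_faces[OF x(1)] by (intro card_subset_eq) auto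
    then show ?thesis using v by blast
  qed
  moreover have "y - {v} \<in> faces K j" if "v \<in> y" for v
    using subface[OF assms, of "y - {v}"] that fin card by auto
  ultimately show ?thesis by blast
qed

lemma inj_on_remove: "inj_on (\<lambda>v. y - {v}) y"
  by (auto simp: inj_on_def)

text \<open>Deleting the marked vertex is a bijection from faces with a marked vertex to smaller
  faces with a marked extension. It underlies both the adjointness of up and down and the
  localisation to links.\<close>

lemma sum_face_pairs:
  fixes F :: "nat set \<Rightarrow> nat \<Rightarrow> real"
  shows "(\<Sum>y\<in>faces K (Suc j). \<Sum>b\<in>y. F y b) = (\<Sum>s\<in>faces K j. \<Sum>b\<in>ext K s. F (insert b s) b)"
proof -
  have "(\<Sum>y\<in>faces K (Suc j). \<Sum>b\<in>y. F y b) = (\<Sum>(y, b)\<in>(SIGMA y:faces K (Suc j). y). F y b)"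
    using finite_faces finite_face by (intro sum.Sigma) auto
  also have "\<dots> = (\<Sum>(s, b)\<in>(SIGMA s:faces K j. ext K s). F (insert b s) b)"
  proof (rule sum.reindex_bij_witness[where i = "\<lambda>(s, b). (insert b s, b)" and j = "\<lambda>(y, b). (y - {b}, b)"])
    fix p assume "p \<in> (SIGMA y:faces K (Suc j). y)"
    then obtain y b where p: "p = (y, b)" "y \<in> faces K (Suc j)" "b \<in> y" by auto
    then have "y - {b} \<in> faces K j" using subfaces_eq[OF p(2)] by blast
    then show "(case p of (y, b) \<Rightarrow> (y - {b}, b)) \<in> (SIGMA s:faces K j. ext K s)"
      using p card_faces by (auto simp: ext_def insert_absorb)
  qed (auto simp: insert_absorb ext_def card_faces)
  also have "\<dots> = (\<Sum>s\<in>faces K j. \<Sum>b\<in>ext K s. F (insert b s) b)"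
    using finite_faces finite_ext by (intro sum.Sigma[symmetric]) auto
  finally show ?thesis .
qed

section \<open>Face weights as normalised facet masses\<close>

lemma face_weight_top: "face_weight K (cdim K) x = wt K x"
  by (simp add: face_weight.simps)

lemma face_weight_rec:
  assumes "j < cdim K" "x \<in> faces K j"
  shows "(\<Sum>v\<in>ext K x. face_weight K (Suc j) (insert v x)) = real (Suc j) * face_weight K j x"
proof -
  have "face_weight K j x = 1 / real (Suc j) * (\<Sum>y\<in>{y \<in> faces K (Suc j). x \<subset> y}. face_weight K (Suc j) y)"
    using assms by (subst face_weight.simps) simp
  also have "(\<Sum>y\<in>{y \<in> faces K (Suc j). x \<subset> y}. face_weight K (Suc j) y) =
      (\<Sum>v\<in>ext K x. face_weight K (Suc j) (insert v x))"
    unfolding superfaces_eq[OF assms(2)] by (simp add: sum.reindex[OF inj_on_insert_ext])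
  finally show ?thesis by (simp add: field_simps)
qed

lemma face_weight_pos:
  assumes "x \<in> faces K j"
  shows "0 < face_weight K j x"
  using faces_dim[OF assms] assms
proof (induction j arbitrary: x rule: inc_induct)
  case base
  then show ?case using wc by (simp add: face_weight_top faces_top weighted_complex_def)
next
  case (step j)
  have "0 < (\<Sum>v\<in>ext K x. face_weight K (Suc j) (insert v x))"
    using step face_extend[of x j] finite_ext card_faces[OF step.prems]
    by (intro sum_pos) (auto simp: ext_def)
  then show ?case
    unfolding face_weight_rec[OF step.hyps(2) step.prems] by (simp add: zero_less_mult_iff)
qed

lemma face_weight_nonneg: "x \<in> faces K j \<Longrightarrow> 0 \<le> face_weight K j x"
  using face_weight_pos less_imp_le by blast

lemma mass_pos: "x \<in> faces K j \<Longrightarrow> 0 < mass K x"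
  unfolding mass_def using wc finite_facets
  by (intro sum_pos) (auto simp: faces_def weighted_complex_def)

lemma mass_eq_0: "x \<notin> faces K (card x) \<Longrightarrow> mass K x = 0"
  unfolding mass_def by (intro sum.neutral) (auto simp: faces_def)

lemma mass_nonneg: "0 \<le> mass K x"
  unfolding mass_def using wc by (intro sum_nonneg) (auto simp: weighted_complex_def less_imp_le)

text \<open>Double counting: each facet above x is counted once for each of its vertices outside
  x.\<close>

lemma sum_mass_ext:
  assumes "x \<in> faces K j"
  shows "(\<Sum>v\<in>ext K x. mass K (insert v x)) = real (cdim K - j) * mass K x"
proof -
  let ?T = "{t \<in> facets K. x \<subseteq> t}"
  have "(\<Sum>v\<in>ext K x. mass K (insert v x)) = (\<Sum>v\<in>ext K x. \<Sum>t\<in>{t \<in> ?T. v \<in> t}. wt K t)"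
    unfolding mass_def by (intro sum.cong refl) auto
  also have "\<dots> = (\<Sum>t\<in>?T. \<Sum>v\<in>{v \<in> ext K x. v \<in> t}. wt K t)"
    using finite_ext finite_facets by (intro sum.swap_restrict) auto
  also have "\<dots> = (\<Sum>t\<in>?T. real (cdim K - j) * wt K t)"
  proof (intro sum.cong refl)
    fix t assume t: "t \<in> ?T"
    then have "{v \<in> ext K x. v \<in> t} = t - x"
      using finite_face[OF assms] by (auto simp: ext_def faces_def)
    moreover have "card (t - x) = cdim K - j"
      using t facet_finite_card finite_face[OF assms] card_faces[OF assms] by (simp add: card_Diff_subset)
    ultimately show "(\<Sum>v\<in>{v \<in> ext K x. v \<in> t}. wt K t) = real (cdim K - j) * wt K t" by simp
  qed
  finally show ?thesis by (simp add: mass_def sum_distrib_left)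
qed

text \<open>A random j-face is a uniform j-subset of a random facet. Conditional probabilities
  thereby become ratios of masses, without the recursion.\<close>

lemma face_weight_mass:
  assumes "x \<in> faces K j"
  shows "face_weight K j x = mass K x / real (cdim K choose j)"
  using faces_dim[OF assms] assms
proof (induction j arbitrary: x rule: inc_induct)
  case base
  then have "x \<in> facets K" by (simp add: faces_top)
  then have "t = x" if "t \<in> facets K" "x \<subseteq> t" for t
    using that facet_finite_card[of t] facet_finite_card[of x] card_subset_eq[of t x] by simp
  then have "{t \<in> facets K. x \<subseteq> t} = {x}" using \<open>x \<in> facets K\<close> by blast
  then show ?case by (simp add: face_weight_top mass_def)
next
  case (step j)
  let ?d = "cdim K"
  have "real (Suc j) * face_weight K j x = (\<Sum>v\<in>ext K x. mass K (insert v x) / real (?d choose Suc j))"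
    unfolding face_weight_rec[OF step.hyps(2) step.prems, symmetric]
    using step.IH card_faces[OF step.prems] by (intro sum.cong refl) (auto simp: ext_def)
  also have "\<dots> = real (?d - j) * mass K x / real (?d choose Suc j)"
    unfolding sum_divide_distrib[symmetric] sum_mass_ext[OF step.prems] ..
  finally have eq: "real (Suc j) * face_weight K j x = real (?d - j) * mass K x / real (?d choose Suc j)" .
  have "real (Suc j) * real (?d choose Suc j) = real (?d - j) * real (?d choose j)"
    using step.hyps(2) by (rule Suc_times_choose_Suc)
  moreover have "real (?d choose Suc j) > 0" "real (?d choose j) > 0" using step.hyps(2) by auto
  ultimately have "real (Suc j) * face_weight K j x = real (Suc j) * (mass K x / real (?d choose j))"
    unfolding eq by (simp add: divide_simps del: of_nat_Suc)
  then show ?case by (metis mult_cancel_left of_nat_neq_0)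
qed

section \<open>Up and down as adjoint averaging operators\<close>

lemma up_eq:
  assumes "y \<in> faces K (Suc j)"
  shows "up K j f y = (\<Sum>v\<in>y. f (y - {v})) / real (Suc j)"
  by (simp add: up_def subfaces_eq[OF assms] sum.reindex[OF inj_on_remove])

lemma down_eq:
  assumes "x \<in> faces K j"
  shows "down K j f x =
    (\<Sum>v\<in>ext K x. face_weight K (Suc j) (insert v x) * f (insert v x)) / (real (Suc j) * face_weight K j x)"
  by (simp add: down_def superfaces_eq[OF assms] sum.reindex[OF inj_on_insert_ext] sum_divide_distrib
    sum_distrib_left mult_ac)

lemma inner_up_down:
  assumes "j < cdim K"
  shows "inner_faces K (Suc j) (up K j f) g = inner_faces K j f (down K j g)"
proof -
  have "inner_faces K (Suc j) (up K j f) g =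
      (\<Sum>y\<in>faces K (Suc j). \<Sum>b\<in>y. face_weight K (Suc j) y * g y * f (y - {b})) / real (Suc j)"
    unfolding inner_faces_def sum_divide_distrib[of _ "faces K (Suc j)"]
    by (intro sum.cong refl) (simp add: up_eq sum_distrib_left mult_ac)
  also have "\<dots> = (\<Sum>s\<in>faces K j. \<Sum>b\<in>ext K s.
      face_weight K (Suc j) (insert b s) * g (insert b s) * f (insert b s - {b})) / real (Suc j)"
    by (subst sum_face_pairs) simp
  also have "\<dots> = inner_faces K j f (down K j g)"
    unfolding inner_faces_def sum_divide_distrib[of _ "faces K j"]
  proof (intro sum.cong refl)
    fix s assume s: "s \<in> faces K j"
    have "(\<Sum>b\<in>ext K s. face_weight K (Suc j) (insert b s) * g (insert b s) * f (insert b s - {b}))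
      = (\<Sum>b\<in>ext K s. face_weight K (Suc j) (insert b s) * g (insert b s)) * f s"
      unfolding sum_distrib_right by (intro sum.cong refl) (auto simp: ext_def)
    then show "(\<Sum>b\<in>ext K s. face_weight K (Suc j) (insert b s) * g (insert b s) * f (insert b s - {b}))
        / real (Suc j) = face_weight K j s * (f s * down K j g s)"
      using face_weight_pos[OF s] by (simp add: down_eq[OF s] divide_simps mult_ac del: of_nat_Suc)
  qed
  finally show ?thesis .
qed

lemma up_const: "y \<in> faces K (Suc j) \<Longrightarrow> up K j (\<lambda>_. c) y = c"
  by (simp add: up_eq card_faces)

lemma down_const: "j < cdim K \<Longrightarrow> x \<in> faces K j \<Longrightarrow> down K j (\<lambda>_. c) x = c"
  using face_weight_rec[of j x] face_weight_pos[of x j]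
  by (simp add: down_eq del: of_nat_Suc flip: sum_distrib_right)

lemma up_power2_le:
  assumes "y \<in> faces K (Suc j)"
  shows "(up K j f y)\<^sup>2 \<le> up K j (\<lambda>x. (f x)\<^sup>2) y"
proof -
  have "(\<Sum>v\<in>y. 1 * f (y - {v}))\<^sup>2 \<le> (\<Sum>v\<in>y. 1\<^sup>2) * (\<Sum>v\<in>y. (f (y - {v}))\<^sup>2)"
    by (rule Cauchy_Schwarz_ineq_sum)
  then show ?thesis
    using assms by (simp add: up_eq card_faces power_divide power2_eq_square divide_simps mult_ac del: of_nat_Suc)
qed

text \<open>Jensen's inequality for the probabilities p v of adding v to x, which sum to 1 because
  down fixes constants.\<close>

lemma down_power2_le:
  assumes "j < cdim K" "x \<in> faces K j"
  shows "(down K j f x)\<^sup>2 \<le> down K j (\<lambda>x. (f x)\<^sup>2) x"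
proof -
  define p where "p v = face_weight K (Suc j) (insert v x) / (real (Suc j) * face_weight K j x)" for v
  have p: "0 \<le> p v" if "v \<in> ext K x" for v
    using that assms card_faces[OF assms(2)] face_weight_nonneg
    by (auto simp: p_def ext_def intro!: divide_nonneg_nonneg)
  have D: "down K j h x = (\<Sum>v\<in>ext K x. p v * h (insert v x))" for h
    by (simp add: down_eq[OF assms(2)] p_def sum_divide_distrib)
  have "(\<Sum>v\<in>ext K x. sqrt (p v) * (sqrt (p v) * f (insert v x)))\<^sup>2
      \<le> (\<Sum>v\<in>ext K x. (sqrt (p v))\<^sup>2) * (\<Sum>v\<in>ext K x. (sqrt (p v) * f (insert v x))\<^sup>2)"
    by (rule Cauchy_Schwarz_ineq_sum)
  also have "(\<Sum>v\<in>ext K x. sqrt (p v) * (sqrt (p v) * f (insert v x))) = down K j f x"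
    unfolding D by (intro sum.cong refl) (simp add: p flip: mult.assoc)
  also have "(\<Sum>v\<in>ext K x. (sqrt (p v))\<^sup>2) = down K j (\<lambda>_. 1) x"
    unfolding D by (intro sum.cong refl) (simp add: p)
  also have "(\<Sum>v\<in>ext K x. (sqrt (p v) * f (insert v x))\<^sup>2) = down K j (\<lambda>x. (f x)\<^sup>2) x"
    unfolding D by (intro sum.cong refl) (simp add: p power_mult_distrib)
  finally show ?thesis using down_const[OF assms] by simp
qed

lemma inner_faces_mono:
  "(\<And>x. x \<in> faces K j \<Longrightarrow> f x * g x \<le> f' x * g' x) \<Longrightarrow> inner_faces K j f g \<le> inner_faces K j f' g'"
  unfolding inner_faces_def by (intro sum_mono mult_left_mono) (auto intro: face_weight_nonneg)

lemma inner_faces_cong: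
  "(\<And>x. x \<in> faces K j \<Longrightarrow> f x * g x = f' x * g' x) \<Longrightarrow> inner_faces K j f g = inner_faces K j f' g'"
  unfolding inner_faces_def by (intro sum.cong) auto

lemma inner_faces_self_nonneg: "0 \<le> inner_faces K j f f"
  unfolding inner_faces_def by (intro sum_nonneg mult_nonneg_nonneg zero_le_square) (auto intro: face_weight_nonneg)

text \<open>Jensen pointwise; then adjointness moves the averaging onto the constant 1, which it
  fixes.\<close>

lemma inner_up_up_le:
  assumes "j < cdim K"
  shows "inner_faces K (Suc j) (up K j f) (up K j f) \<le> inner_faces K j f f"
proof -
  have "inner_faces K (Suc j) (up K j f) (up K j f) \<le> inner_faces K (Suc j) (up K j (\<lambda>x. (f x)\<^sup>2)) (\<lambda>_. 1)"
    using up_power2_le by (intro inner_faces_mono) (simp add: power2_eq_square)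
  also have "\<dots> = inner_faces K j (\<lambda>x. (f x)\<^sup>2) (down K j (\<lambda>_. 1))"
    by (rule inner_up_down[OF assms])
  also have "\<dots> = inner_faces K j f f"
    using down_const[OF assms] by (intro inner_faces_cong) (simp add: power2_eq_square)
  finally show ?thesis .
qed

lemma inner_down_down_le:
  assumes "j < cdim K"
  shows "inner_faces K j (down K j f) (down K j f) \<le> inner_faces K (Suc j) f f"
proof -
  have "inner_faces K j (down K j f) (down K j f) \<le> inner_faces K j (\<lambda>_. 1) (down K j (\<lambda>x. (f x)\<^sup>2))"
    using down_power2_le[OF assms] by (intro inner_faces_mono) (simp add: power2_eq_square)
  also have "\<dots> = inner_faces K (Suc j) (up K j (\<lambda>_. 1)) (\<lambda>x. (f x)\<^sup>2)"
    by (rule inner_up_down[OF assms, symmetric])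
  also have "\<dots> = inner_faces K (Suc j) f f"
    using up_const by (intro inner_faces_cong) (simp add: power2_eq_square)
  finally show ?thesis .
qed

end

section \<open>Links\<close>

text \<open>Draw a facet above x by weight, then one of its vertices outside x uniformly: for v
  outside x this is the chance of v. It is at once the transition probability of the down operator
  and the weight of the vertex v in the link of x.\<close>

definition step_prob :: "wcomplex \<Rightarrow> nat set \<Rightarrow> nat \<Rightarrow> real" where
  "step_prob K x v = mass K (insert v x) / (real (cdim K - card x) * mass K x)"

context
  fixes K
  assumes wc: "weighted_complex K"
begin

lemma facets_link: "facets (link K s) = (\<lambda>t. t - s) ` {t \<in> facets K. s \<subseteq> t}"
  by (auto simp: link_def)

lemma wt_link: "s \<subseteq> t \<Longrightarrow> wt (link K s) (t - s) = wt K t / mass K s"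
  by (simp add: link_def mass_def Un_absorb1)

lemma mass_link:
  assumes "u \<inter> s = {}"
  shows "mass (link K s) u = mass K (s \<union> u) / mass K s"
proof -
  have "{r \<in> facets (link K s). u \<subseteq> r} = (\<lambda>t. t - s) ` {t \<in> facets K. s \<union> u \<subseteq> t}"
    using assms by (auto simp: facets_link)
  moreover have "inj_on (\<lambda>t. t - s) {t \<in> facets K. s \<union> u \<subseteq> t}"
    by (auto simp: inj_on_def)
  ultimately have "mass (link K s) u = (\<Sum>t\<in>{t \<in> facets K. s \<union> u \<subseteq> t}. wt (link K s) (t - s))"
    unfolding mass_def[of "link K s"] by (simp add: sum.reindex)
  also have "\<dots> = mass K (s \<union> u) / mass K s"
    unfolding mass_def[of K "s \<union> u"] sum_divide_distrib by (intro sum.cong refl) (simp add: wt_link)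
  finally show ?thesis .
qed

lemma weighted_complex_link:
  assumes "s \<in> faces K j"
  shows "weighted_complex (link K s)"
  unfolding weighted_complex_def
proof (intro conjI)
  show "facets (link K s) \<subseteq> {t. t \<subseteq> {1..nverts (link K s)} \<and> card t = cdim (link K s)}"
  proof
    fix u assume "u \<in> facets (link K s)"
    then obtain t where t: "t \<in> facets K" "s \<subseteq> t" "u = t - s" by (auto simp: facets_link)
    moreover have "t \<subseteq> {1..nverts K}" "card t = cdim K"
      using t(1) wc by (auto simp: weighted_complex_def)
    ultimately show "u \<in> {t. t \<subseteq> {1..nverts (link K s)} \<and> card t = cdim (link K s)}"
      using finite_face[OF wc assms] by (auto simp: link_def card_Diff_subset)
  qed
  show "\<forall>t\<in>facets (link K s). 0 < wt (link K s) t"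
    using wc mass_pos[OF wc assms] by (auto simp: facets_link wt_link weighted_complex_def)
  have "(\<Sum>t\<in>facets (link K s). wt (link K s) t) = mass (link K s) {}"
    by (simp add: mass_def)
  then show "(\<Sum>t\<in>facets (link K s). wt (link K s) t) = 1"
    using mass_pos[OF wc assms] by (simp add: mass_link)
qed

lemma faces_link:
  "u \<in> faces (link K s) i \<longleftrightarrow> card u = i \<and> u \<inter> s = {} \<and> (\<exists>t\<in>facets K. s \<union> u \<subseteq> t)"
  by (auto simp: faces_def facets_link)

lemma vertices_link:
  assumes "s \<in> faces K j"
  shows "vertices (link K s) = ext K s"
proof -
  have "v \<in> vertices (link K s) \<longleftrightarrow> v \<in> ext K s" for v
    unfolding vertices_def mem_Collect_eq faces_link
    using finite_face[OF wc assms] by (simp add: ext_def faces_def cong: conj_cong)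
  then show ?thesis by blast
qed

text \<open>The vertices joined to v in the link of s are the extensions of
  \<open>insert v s\<close>; for all other u the mass is 0, which reduces the sum to
  \<open>sum_mass_ext\<close>.\<close>

lemma sum_mass_edges:
  assumes s: "s \<in> faces K j" and v: "v \<in> ext K s"
  shows "(\<Sum>u\<in>ext K s - {v}. mass K (insert u (insert v s))) = real (cdim K - Suc j) * mass K (insert v s)"
proof -
  have vs: "insert v s \<in> faces K (Suc j)" using v card_faces[OF s] by (simp add: ext_def)
  have card_uv: "card (insert u (insert v s)) = Suc (Suc j)" if "u \<notin> s" "u \<noteq> v" for u
    using that v card_faces[OF s] finite_face[OF wc s] by (simp add: ext_def)
  have "ext K (insert v s) \<subseteq> ext K s - {v}"
  proof
    fix u assume u: "u \<in> ext K (insert v s)"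
    then have "insert u s \<in> faces K (card (insert u s))"
      by (intro subface[OF wc, of "insert u (insert v s)"]) (auto simp: ext_def)
    then show "u \<in> ext K s - {v}"
      using u card_faces[OF s] finite_face[OF wc s] by (auto simp: ext_def)
  qed
  moreover have "mass K (insert u (insert v s)) = 0" if "u \<in> ext K s - {v} - ext K (insert v s)" for u
    using that card_uv[of u] card_faces[OF vs]
    by (intro mass_eq_0[OF wc]) (auto simp: ext_def)
  ultimately have "(\<Sum>u\<in>ext K s - {v}. mass K (insert u (insert v s))) =
      (\<Sum>u\<in>ext K (insert v s). mass K (insert u (insert v s)))"
    using finite_ext[OF wc] by (intro sum.mono_neutral_right) auto
  then show ?thesis unfolding sum_mass_ext[OF wc vs] .
qed

text \<open>The walk on the link of s is an instance of the abstract graph: edge weights are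
  normalised masses, the degree of v is its \<open>step_prob\<close> over s, and the transition
  probability from b to a is the \<open>step_prob\<close> of a over
  \<open>insert b s\<close>.\<close>

lemma
  assumes s: "s \<in> faces K j" and j: "j + 2 \<le> cdim K"
    and ev: "\<And>\<mu>. nontrivial_eigenvalue (link K s) \<mu> \<Longrightarrow> \<bar>\<mu>\<bar> \<le> \<gamma>"
    and a: "a \<in> ext K s"
  shows step_prob_le: "step_prob K s a \<le> \<gamma>"
    and sum_step_prob_square_le: "\<gamma> \<le> 1 \<Longrightarrow>
      (\<Sum>b\<in>ext K s - {a}. step_prob K s b * (step_prob K (insert b s) a)\<^sup>2) \<le> 2 * \<gamma> * step_prob K s a"
proof -
  define m where "m = real (cdim K - j)"
  have m2: "m \<ge> 2" using j by (simp add: m_def)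
  have m1: "real (cdim K - Suc j) = m - 1" using j by (simp add: m_def)
  have ms: "0 < mass K s" using mass_pos[OF wc s] .
  have ins: "insert v s \<in> faces K (Suc j)" if "v \<in> ext K s" for v
    using that card_faces[OF s] by (simp add: ext_def)
  have mv: "0 < mass K (insert v s)" if "v \<in> ext K s" for v
    using mass_pos[OF wc ins[OF that]] .
  \<comment> \<open>m (m - 1) counts the ordered pairs of vertices that a facet above s has outside
    s, which makes the total weight 1.\<close>
  define w where "w u v = (if u = v then 0 else mass K (insert u (insert v s)) / (m * (m - 1) * mass K s))" for u v
  have sum_w: "(\<Sum>y\<in>ext K s. w v y) = step_prob K s v" if v: "v \<in> ext K s" for v
  proof -
    have "(\<Sum>y\<in>ext K s. w v y) = (\<Sum>y\<in>ext K s - {v}. mass K (insert y (insert v s)) / (m * (m - 1) * mass K s))"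
      using v finite_ext[OF wc]
      by (intro sum.mono_neutral_cong_right) (auto simp: w_def insert_commute)
    also have "\<dots> = (m - 1) * mass K (insert v s) / (m * (m - 1) * mass K s)"
      unfolding sum_divide_distrib[symmetric] sum_mass_edges[OF s v] m1 ..
    also have "\<dots> = step_prob K s v"
      using m2 card_faces[OF s] by (simp add: step_prob_def m_def)
    finally show ?thesis .
  qed
  have step_pos: "0 < step_prob K s v" if "v \<in> ext K s" for v
    using mv[OF that] ms m2 card_faces[OF s] by (simp add: step_prob_def m_def)
  interpret G: loopless_weighted_graph "ext K s" w
  proof
    show "finite (ext K s)" using finite_ext[OF wc] .
    show "w x y = w y x" for x y by (simp add: w_def insert_commute)
    show "w x x = 0" for x by (simp add: w_def)
    show "0 < (\<Sum>y\<in>ext K s. w x y)" if "x \<in> ext K s" for x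
      using sum_w[OF that] step_pos[OF that] by simp
    have "(\<Sum>x\<in>ext K s. \<Sum>y\<in>ext K s. w x y) = (\<Sum>x\<in>ext K s. mass K (insert x s)) / (m * mass K s)"
      unfolding sum_divide_distrib using card_faces[OF s]
      by (intro sum.cong refl) (simp add: sum_w step_prob_def m_def)
    also have "\<dots> = 1" using sum_mass_ext[OF wc s] m2 ms by (simp add: m_def)
    finally show "(\<Sum>x\<in>ext K s. \<Sum>y\<in>ext K s. w x y) = 1" .
  qed
  have deg: "G.deg v = step_prob K s v" if "v \<in> ext K s" for v
    using sum_w[OF that] by (simp add: G.deg_def)
  let ?L = "link K s"
  have wL: "weighted_complex ?L" by (rule weighted_complex_link[OF s])
  have dL: "real (cdim ?L) = m" "2 \<le> cdim ?L"
    using j card_faces[OF s] by (auto simp: link_def m_def)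
  have walk: "graph_walk ?L f v = G.walk f v" if v: "v \<in> ext K s" for f v
  proof -
    have v1: "{v} \<in> faces ?L 1" using v vertices_link[OF s] by (auto simp: vertices_def)
    have "v \<notin> s" using v by (simp add: ext_def)
    have "{e \<in> faces ?L 2. v \<in> e} = {e \<in> faces ?L (Suc 1). {v} \<subset> e}"
      by (auto simp: faces_def numeral_2_eq_2 psubset_eq)
    also have "(\<Sum>e\<in>\<dots>. face_weight ?L 2 e) = 2 * face_weight ?L 1 {v}"
      using face_weight_rec[OF wL _ v1] dL
      by (simp add: superfaces_eq[OF wL v1, unfolded One_nat_def] sum.reindex[OF inj_on_insert_ext[OF wL]] numeral_2_eq_2)
    finally have den: "(\<Sum>e\<in>{e \<in> faces ?L 2. v \<in> e}. face_weight ?L 2 e) = 2 * face_weight ?L 1 {v}" .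
    have "face_weight ?L 1 {v} = mass K (insert v s) / mass K s / m"
      using face_weight_mass[OF wL v1] \<open>v \<notin> s\<close> dL by (simp add: mass_link)
    then have den': "2 * face_weight ?L 1 {v} = 2 * step_prob K s v"
      using card_faces[OF s] by (simp add: step_prob_def m_def mult.commute)
    have choose2: "real (cdim ?L choose 2) = m * (m - 1) / 2"
    proof -
      have "even (cdim ?L * (cdim ?L - 1))" by auto
      then have "2 * (cdim ?L choose 2) = cdim ?L * (cdim ?L - 1)"
        unfolding choose_two by (rule dvd_mult_div_cancel)
      then have "2 * real (cdim ?L choose 2) = real (cdim ?L) * real (cdim ?L - 1)"
        by (metis of_nat_mult of_nat_numeral)
      then show ?thesis using dL by (simp add: of_nat_diff)
    qed
    \<comment> \<open>Face weights refer to unordered edges and w to ordered pairs; this factor 2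
      cancels the one that \<open>face_weight_rec\<close> puts into the denominator.\<close>
    have num: "face_weight ?L 2 {u, v} / (2 * step_prob K s v) = w v u / step_prob K s v"
      if "{u, v} \<in> faces ?L 2" for u
    proof -
      have "u \<noteq> v" "u \<notin> s" using that by (auto simp: faces_link)
      then have "mass ?L {u, v} = mass K (insert v (insert u s)) / mass K s"
        using \<open>v \<notin> s\<close> by (subst mass_link) (auto simp: insert_commute)
      then have "face_weight ?L 2 {u, v} = 2 * w v u"
        using face_weight_mass[OF wL that] choose2 \<open>u \<noteq> v\<close> m2 by (simp add: w_def field_simps)
      then show ?thesis by simp
    qed
    have zero: "w v u = 0" if "u \<in> ext K s" "{u, v} \<notin> faces ?L 2" for u
    proof (cases "u = v")
      case False
      have "insert v (insert u s) \<notin> faces K n" for n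
      proof
        assume "insert v (insert u s) \<in> faces K n"
        then obtain t where "t \<in> facets K" "s \<union> {u, v} \<subseteq> t" by (auto simp: faces_def)
        moreover have "u \<notin> s" using that(1) by (simp add: ext_def)
        ultimately show False
          using that(2) False \<open>v \<notin> s\<close> unfolding faces_link by auto
      qed
      then have "mass K (insert v (insert u s)) = 0" by (rule mass_eq_0[OF wc])
      then show ?thesis by (simp add: w_def)
    qed (simp add: w_def)
    have "graph_walk ?L f v = (\<Sum>u\<in>{u \<in> ext K s. {u, v} \<in> faces ?L 2}. w v u / step_prob K s v * f u)"
      unfolding graph_walk_def den den' vertices_link[OF s] using num by (intro sum.cong refl) auto
    also have "\<dots> = (\<Sum>u\<in>ext K s. w v u / step_prob K s v * f u)"
      using finite_ext[OF wc] zero by (intro sum.mono_neutral_left) auto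
    finally show ?thesis by (simp add: G.walk_def deg[OF v] sum_divide_distrib)
  qed
  have "G.eigenvalue_bound \<gamma>"
    unfolding G.eigenvalue_bound_def
  proof (intro allI impI)
    fix \<mu> f assume f: "\<forall>x\<in>ext K s. G.walk f x = \<mu> * f x" "\<not> (\<exists>c. \<forall>x\<in>ext K s. f x = c)"
    then have "nontrivial_eigenvalue ?L \<mu>"
      unfolding nontrivial_eigenvalue_def vertices_link[OF s] by (intro exI[of _ f]) (simp add: walk)
    then show "\<bar>\<mu>\<bar> \<le> \<gamma>" by (rule ev)
  qed
  note bounds = G.deg_le[OF this a] G.sum_square_transition_le[OF this a]
  show "step_prob K s a \<le> \<gamma>" using bounds(1) deg[OF a] by simp
  assume "\<gamma> \<le> 1"
  have "(\<Sum>b\<in>ext K s - {a}. step_prob K s b * (step_prob K (insert b s) a)\<^sup>2)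
      = (\<Sum>b\<in>ext K s. G.deg b * (w b a / G.deg b)\<^sup>2)"
  proof (rule sum.mono_neutral_cong_left)
    fix b assume b: "b \<in> ext K s - {a}"
    have "w b a / step_prob K s b = step_prob K (insert b s) a"
      using b m2 ms mv[of b] m1 card_faces[OF s] card_faces[OF ins[of b]]
      by (simp add: w_def step_prob_def insert_commute m_def[symmetric])
    then show "step_prob K s b * (step_prob K (insert b s) a)\<^sup>2 = G.deg b * (w b a / G.deg b)\<^sup>2"
      using b by (simp add: deg)
  qed (use finite_ext[OF wc] in \<open>auto simp: w_def\<close>)
  then show "(\<Sum>b\<in>ext K s - {a}. step_prob K s b * (step_prob K (insert b s) a)\<^sup>2) \<le> 2 * \<gamma> * step_prob K s a"
    using bounds(2)[OF \<open>\<gamma> \<le> 1\<close>] deg[OF a] by simp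
qed

end

section \<open>The indicator of the faces containing a given face\<close>

text \<open>One function on all sets serves as the indicator at every level; the level is supplied
  by the inner product or the operator.\<close>

definition ind :: "nat set \<Rightarrow> nat set \<Rightarrow> real" where
  "ind \<tau> x = (if \<tau> \<subseteq> x then 1 else 0)"

definition excess :: "wcomplex \<Rightarrow> nat set \<Rightarrow> nat \<Rightarrow> nat set \<Rightarrow> real" where
  "excess K \<tau> j x = down K j (ind \<tau>) x - ind \<tau> x"

text \<open>The fraction of the j vertices of a face above \<tau> whose removal keeps \<tau>. The
  maximum makes it 0 when 0 < j <= i, as no face of size j - 1 can then contain \<tau>.\<close>

definition level_factor :: "nat \<Rightarrow> nat \<Rightarrow> real" where
  "level_factor i j = 1 - real i / max (real i) (real j)"

lemma level_factor_nonneg: "0 \<le> level_factor i j"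
  by (cases "max (real i) (real j) = 0") (auto simp: level_factor_def divide_le_eq_1)

context
  fixes K
  assumes wc: "weighted_complex K"
begin

text \<open>The factor \<open>Suc j\<close> turns one binomial normalisation into the next, so they
  cancel and only a ratio of masses remains.\<close>

lemma down_step_prob:
  assumes "x \<in> faces K j" "j < cdim K"
  shows "down K j f x = (\<Sum>v\<in>ext K x. step_prob K x v * f (insert v x))"
proof -
  have "face_weight K (Suc j) (insert v x) / (real (Suc j) * face_weight K j x) = step_prob K x v"
    if v: "v \<in> ext K x" for v
  proof -
    have vx: "insert v x \<in> faces K (Suc j)" using v card_faces[OF assms(1)] by (simp add: ext_def)
    have "real (Suc j) * face_weight K j x = real (Suc j) * mass K x / real (cdim K choose j)"
      by (simp add: face_weight_mass[OF wc assms(1)] del: of_nat_Suc)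
    also have "\<dots> = real (cdim K - j) * mass K x / real (cdim K choose Suc j)"
      using Suc_times_choose_Suc[OF assms(2)] assms(2)
      by (simp add: divide_simps mult_ac del: of_nat_Suc)
    finally show ?thesis
      using assms(2) mass_pos[OF wc assms(1)] card_faces[OF assms(1)]
      by (simp add: face_weight_mass[OF wc vx] step_prob_def)
  qed
  then show ?thesis
    by (simp add: down_eq[OF wc assms(1)] sum_divide_distrib flip: times_divide_eq_left)
qed

lemma step_prob_nonneg: "0 \<le> step_prob K x v"
  unfolding step_prob_def by (intro divide_nonneg_nonneg mult_nonneg_nonneg mass_nonneg[OF wc]) simp

lemma up_ind:
  assumes y: "y \<in> faces K (Suc j)" and \<tau>: "finite \<tau>" "card \<tau> = i"
  shows "up K j (ind \<tau>) y = level_factor i (Suc j) * ind \<tau> y"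
proof (cases "\<tau> \<subseteq> y")
  case True
  have fin: "finite y" using finite_face[OF wc y] .
  have le: "i \<le> Suc j" using card_mono[OF fin True] \<tau> card_faces[OF y] by simp
  have "(\<Sum>v\<in>y. ind \<tau> (y - {v})) = (\<Sum>v\<in>y - \<tau>. 1)"
    using fin True by (intro sum.mono_neutral_cong_right) (auto simp: ind_def)
  also have "\<dots> = real (Suc j) - real i"
    using True \<tau> le card_faces[OF y] by (simp add: card_Diff_subset of_nat_diff)
  finally show ?thesis
    using True le
    by (simp add: up_eq[OF wc y] level_factor_def ind_def max_absorb2 diff_divide_distrib del: of_nat_Suc)
next
  case False
  then have "ind \<tau> (y - {v}) = 0" for v by (auto simp: ind_def)
  then show ?thesis using False by (simp add: up_eq[OF wc y] ind_def)
qed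

section \<open>The excess of the down operator\<close>

lemma excess_contained: "x \<in> faces K j \<Longrightarrow> j < cdim K \<Longrightarrow> \<tau> \<subseteq> x \<Longrightarrow> excess K \<tau> j x = 0"
proof -
  assume x: "x \<in> faces K j" "j < cdim K" "\<tau> \<subseteq> x"
  have "down K j (ind \<tau>) x = down K j (\<lambda>_. 1) x"
    unfolding down_step_prob[OF x(1,2)] using x(3)
    by (intro sum.cong refl) (auto simp: ind_def)
  then show ?thesis using x down_const[OF wc x(2,1)] by (simp add: excess_def ind_def)
qed

lemma excess_not_contained:
  assumes "x \<in> faces K j" "j < cdim K" "\<not> \<tau> \<subseteq> x"
  shows "excess K \<tau> j x = (\<Sum>v\<in>ext K x. step_prob K x v * ind \<tau> (insert v x))"
  using assms by (simp add: excess_def down_step_prob ind_def)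

lemma excess_nonneg:
  assumes "x \<in> faces K j" "j < cdim K"
  shows "0 \<le> excess K \<tau> j x"
proof (cases "\<tau> \<subseteq> x")
  case False
  then show ?thesis
    unfolding excess_not_contained[OF assms False]
    by (intro sum_nonneg mult_nonneg_nonneg step_prob_nonneg) (simp add: ind_def)
qed (use assms in \<open>simp add: excess_contained\<close>)

text \<open>A face missing exactly one vertex of \<tau> can be completed by that vertex alone, so
  the average collapses to a single term.\<close>

lemma excess_missing_vertex:
  assumes "x \<in> faces K j" "j < cdim K" "\<not> \<tau> \<subseteq> x" "\<tau> \<subseteq> insert a x"
  shows "excess K \<tau> j x = (if a \<in> ext K x then step_prob K x a else 0)"
proof -
  have "ind \<tau> (insert v x) = (if v = a then 1 else 0)" for v
    using assms(3,4) by (auto simp: ind_def)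
  then show ?thesis
    using finite_ext[OF wc]
    by (simp add: excess_not_contained[OF assms(1-3)] if_distrib[of "(*) _"] cong: if_cong)
qed

lemma excess_far:
  assumes "x \<in> faces K j" "j < cdim K" "\<And>a. \<not> \<tau> \<subseteq> insert a x"
  shows "excess K \<tau> j x = 0"
proof -
  have "\<not> \<tau> \<subseteq> x" using assms(3) by blast
  then show ?thesis
    using assms(3) by (simp add: excess_not_contained[OF assms(1,2)] ind_def)
qed

lemma ind_excess: "x \<in> faces K j \<Longrightarrow> j < cdim K \<Longrightarrow> ind \<tau> x * excess K \<tau> j x = 0"
  using excess_contained by (simp add: ind_def)

lemma excess_le:
  assumes x: "x \<in> faces K j" "j < cdim K" and "0 \<le> \<gamma>"
    and step: "\<And>a. a \<in> ext K x \<Longrightarrow> step_prob K x a \<le> \<gamma>"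
  shows "excess K \<tau> j x \<le> \<gamma>"
proof (cases "\<tau> \<subseteq> x \<or> (\<forall>a. \<not> \<tau> \<subseteq> insert a x)")
  case True
  then show ?thesis using excess_contained[OF x] excess_far[OF x] \<open>0 \<le> \<gamma>\<close> by metis
next
  case False
  then obtain a where "\<not> \<tau> \<subseteq> x" "\<tau> \<subseteq> insert a x" by blast
  then show ?thesis using excess_missing_vertex[OF x] step \<open>0 \<le> \<gamma>\<close> by simp
qed

lemma expander_step_prob_le:
  assumes "two_sided_local_spectral_expander \<gamma> K" "s \<in> faces K j" "j + 2 \<le> cdim K" "a \<in> ext K s"
  shows "step_prob K s a \<le> \<gamma>"
  using assms step_prob_le[OF wc assms(2,3) _ assms(4)]
  unfolding two_sided_local_spectral_expander_def by blast

lemma expander_sum_step_prob_square_le: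
  assumes "two_sided_local_spectral_expander \<gamma> K" "\<gamma> \<le> 1" "s \<in> faces K j" "j + 2 \<le> cdim K" "a \<in> ext K s"
  shows "(\<Sum>b\<in>ext K s - {a}. step_prob K s b * (step_prob K (insert b s) a)\<^sup>2) \<le> 2 * \<gamma> * step_prob K s a"
  using assms sum_step_prob_square_le[OF wc assms(3,4) _ assms(5,2)]
  unfolding two_sided_local_spectral_expander_def by blast

text \<open>The sign of \<gamma> is not part of the expander condition and has to be recovered: a
  step out of the empty face has a nonnegative probability that is bounded by \<gamma>.\<close>

lemma expander_nonneg:
  assumes "two_sided_local_spectral_expander \<gamma> K" "2 \<le> cdim K"
  shows "0 \<le> \<gamma>"
proof -
  have "facets K \<noteq> {}" using wc by (auto simp: weighted_complex_def)
  then have e: "{} \<in> faces K 0" by (auto simp: faces_def)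
  then obtain a where "a \<in> ext K {}" using face_extend[OF wc e] assms(2) by auto
  then have "step_prob K {} a \<le> \<gamma>" using expander_step_prob_le[OF assms(1) e] assms(2) by simp
  then show ?thesis using step_prob_nonneg[of "{}" a] by linarith
qed

text \<open>Up to a constant depending only on s, the weights of the faces just above s form the
  vertex distribution of its link.\<close>

lemma face_weight_insert:
  assumes s: "s \<in> faces K j" "j < cdim K" and v: "v \<in> ext K s"
  shows "face_weight K (Suc j) (insert v s) =
    real (cdim K - j) * mass K s / real (cdim K choose Suc j) * step_prob K s v"
proof -
  have "insert v s \<in> faces K (Suc j)" using v card_faces[OF s(1)] by (simp add: ext_def)
  then show ?thesis
    using s mass_pos[OF wc s(1)] card_faces[OF s(1)]
    by (simp add: face_weight_mass[OF wc] step_prob_def)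
qed

text \<open>
  The link of a \<open>(d - 1)\<close>-face is not controlled by local expansion, so the pointwise bound on
  the excess is not available at the top level. There the square of the excess is localised to
  the links of \<open>(d - 2)\<close>-faces \<open>s\<close> missing a single vertex \<open>a\<close> of \<open>\<tau>\<close>, where it becomes
  \<open>\<parallel>A \<delta>\<^sub>a\<parallel>\<^sup>2\<close> for the walk \<open>A\<close> on the link.
\<close>

lemma inner_excess_top:
  assumes ex: "two_sided_local_spectral_expander \<gamma> K" "\<gamma> \<le> 1"
    and \<tau>: "\<tau> \<in> faces K i" and ij: "i \<le> Suc j" and d: "cdim K = Suc (Suc j)"
  shows "inner_faces K (Suc j) (excess K \<tau> (Suc j)) (excess K \<tau> (Suc j))
    \<le> 2 * real i * \<gamma> * inner_faces K (Suc j) (ind \<tau>) (ind \<tau>)"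
proof -
  let ?e = "excess K \<tau> (Suc j)" and ?w = "face_weight K (Suc j)"
  have \<gamma>0: "0 \<le> \<gamma>" using expander_nonneg[OF ex(1)] d by simp
  have d': "Suc j < cdim K" "j < cdim K" using d by auto
  \<comment> \<open>A face x that misses part of \<tau> is not inside \<tau> either, being at least
    as large. So some b in x lies outside \<tau>, and removing it leaves a face that misses the same
    vertices of \<tau>.\<close>
  have "?w x * (?e x * ?e x) \<le> (\<Sum>b\<in>x. if b \<in> \<tau> then 0 else ?w x * (?e x * ?e x))"
    if x: "x \<in> faces K (Suc j)" for x
  proof (cases "\<tau> \<subseteq> x")
    case True
    then have "?e x = 0" by (rule excess_contained[OF x d'(1)])
    then show ?thesis by (simp only: mult_zero_left mult_zero_right if_cancel sum.neutral_const order_refl)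
  next
    case False
    have "x \<noteq> \<tau>" using False by blast
    then have "\<not> x \<subseteq> \<tau>"
      using card_seteq[OF finite_face[OF wc \<tau>], of x] ij card_faces[OF \<tau>] card_faces[OF x] by auto
    then obtain b where b: "b \<in> x" "b \<notin> \<tau>" by blast
    have "(if b \<in> \<tau> then 0 else ?w x * (?e x * ?e x)) \<le> (\<Sum>b\<in>x. if b \<in> \<tau> then 0 else ?w x * (?e x * ?e x))"
      using b finite_face[OF wc x] face_weight_nonneg[OF wc x]
      by (intro member_le_sum[of b x "\<lambda>b. if b \<in> \<tau> then 0 else ?w x * (?e x * ?e x)"]) auto
    then show ?thesis using b by simp
  qed
  then have "inner_faces K (Suc j) ?e ?e \<le>
      (\<Sum>x\<in>faces K (Suc j). \<Sum>b\<in>x. if b \<in> \<tau> then 0 else ?w x * (?e x * ?e x))"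
    unfolding inner_faces_def by (rule sum_mono)
  also have "\<dots> = (\<Sum>s\<in>faces K j. \<Sum>b\<in>ext K s. if b \<in> \<tau> then 0 else
      ?w (insert b s) * (?e (insert b s) * ?e (insert b s)))"
    by (rule sum_face_pairs[OF wc])
  \<comment> \<open>Compared one s at a time: on the right s is paired with the vertex a of \<tau>
    that it misses. Each face containing \<tau> arises once for every a in \<tau>, whence the factor
    i.\<close>
  also have "\<dots> \<le> (\<Sum>s\<in>faces K j. \<Sum>a\<in>ext K s. if a \<in> \<tau> then 2 * \<gamma> * (?w (insert a s) * ind \<tau> (insert a s)) else 0)"
  proof (rule sum_mono)
    fix s assume s: "s \<in> faces K j"
    have ins: "insert b s \<in> faces K (Suc j)" if "b \<in> ext K s" for b
      using that card_faces[OF s] by (simp add: ext_def)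
    have rhs: "0 \<le> (if a \<in> \<tau> then 2 * \<gamma> * (?w (insert a s) * ind \<tau> (insert a s)) else 0)"
      if "a \<in> ext K s" for a
      using face_weight_nonneg[OF wc ins[OF that]] \<gamma>0 by (simp add: ind_def)
    let ?L = "\<Sum>b\<in>ext K s. if b \<in> \<tau> then 0 else ?w (insert b s) * (?e (insert b s) * ?e (insert b s))"
    let ?R = "\<Sum>a\<in>ext K s. if a \<in> \<tau> then 2 * \<gamma> * (?w (insert a s) * ind \<tau> (insert a s)) else 0"
    have R0: "0 \<le> ?R" using rhs by (rule sum_nonneg)
    show "?L \<le> ?R"
    \<comment> \<open>No excess survives if s contains \<tau> or misses at least two of its
      vertices: adding b outside \<tau> changes neither.\<close>
    proof (cases "\<tau> \<subseteq> s \<or> (\<forall>a. \<not> \<tau> \<subseteq> insert a s)")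
      case True
      have "?e (insert b s) = 0" if b: "b \<in> ext K s" "b \<notin> \<tau>" for b
      proof (cases "\<tau> \<subseteq> s")
        case True
        then show ?thesis using excess_contained[OF ins[OF b(1)] d'(1)] by blast
      next
        case False
        have "\<not> \<tau> \<subseteq> insert a (insert b s)" for a
          using False True b(2) by blast
        then show ?thesis by (rule excess_far[OF ins[OF b(1)] d'(1)])
      qed
      then have "?L = 0" by (intro sum.neutral) auto
      then show ?thesis using R0 by simp
    next
      case False
      then obtain a where a: "\<not> \<tau> \<subseteq> s" "\<tau> \<subseteq> insert a s" by blast
      then have a\<tau>: "a \<in> \<tau>" "a \<notin> s" by auto
      have e: "?e (insert b s) = (if a \<in> ext K (insert b s) then step_prob K (insert b s) a else 0)"
        if b: "b \<in> ext K s" "b \<notin> \<tau>" for b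
        using a a\<tau> b by (intro excess_missing_vertex[OF ins[OF b(1)] d'(1)]) auto
      show ?thesis
      proof (cases "a \<in> ext K s")
        case False
        have "?e (insert b s) = 0" if b: "b \<in> ext K s" "b \<notin> \<tau>" for b
        proof -
          have "a \<notin> ext K (insert b s)"
          proof
            assume "a \<in> ext K (insert b s)"
            then have "insert a s \<in> faces K (card (insert a s))"
              by (intro subface[OF wc, of "insert a (insert b s)"]) (auto simp: ext_def)
            then show False
              using False a\<tau> finite_face[OF wc s] by (simp add: ext_def)
          qed
          then show ?thesis using e[OF b] by simp
        qed
        then have "?L = 0" by (intro sum.neutral) auto
        then show ?thesis using R0 by simp
      next
        case True
        define \<kappa> where "\<kappa> = real (cdim K - j) * mass K s / real (cdim K choose Suc j)"
        have \<kappa>: "0 \<le> \<kappa>" using mass_nonneg[OF wc] by (simp add: \<kappa>_def)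
        have w: "?w (insert b s) = \<kappa> * step_prob K s b" if "b \<in> ext K s" for b
          unfolding \<kappa>_def by (rule face_weight_insert[OF s d'(2) that])
        have "?L \<le> (\<Sum>b\<in>ext K s - {a}. \<kappa> * (step_prob K s b * (step_prob K (insert b s) a)\<^sup>2))"
        proof -
          have "?L = (\<Sum>b\<in>ext K s - {a}. if b \<in> \<tau> then 0 else ?w (insert b s) * (?e (insert b s) * ?e (insert b s)))"
            using a\<tau> finite_ext[OF wc] by (intro sum.mono_neutral_right) auto
          also have "\<dots> \<le> (\<Sum>b\<in>ext K s - {a}. \<kappa> * (step_prob K s b * (step_prob K (insert b s) a)\<^sup>2))"
            using \<kappa> step_prob_nonneg
            by (intro sum_mono) (auto simp: e w power2_eq_square intro!: mult_nonneg_nonneg)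
          finally show ?thesis .
        qed
        also have "\<dots> \<le> \<kappa> * (2 * \<gamma> * step_prob K s a)"
          unfolding sum_distrib_left[symmetric]
          using expander_sum_step_prob_square_le[OF ex s _ True] d \<kappa> by (intro mult_left_mono) auto
        also have "\<dots> = (if a \<in> \<tau> then 2 * \<gamma> * (?w (insert a s) * ind \<tau> (insert a s)) else 0)"
          using a\<tau> a w[OF True] by (simp add: ind_def)
        also have "\<dots> \<le> ?R"
          using True rhs finite_ext[OF wc]
          by (intro member_le_sum[of a _ "\<lambda>a. if a \<in> \<tau> then 2 * \<gamma> * (?w (insert a s) * ind \<tau> (insert a s)) else 0"]) auto
        finally show ?thesis .
      qed
    qed
  qed
  also have "\<dots> = (\<Sum>y\<in>faces K (Suc j). \<Sum>a\<in>y. if a \<in> \<tau> then 2 * \<gamma> * (?w y * ind \<tau> y) else 0)"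
    by (rule sum_face_pairs[OF wc, symmetric])
  also have "\<dots> = (\<Sum>y\<in>faces K (Suc j). 2 * real i * \<gamma> * (?w y * (ind \<tau> y * ind \<tau> y)))"
  proof (intro sum.cong refl)
    fix y assume y: "y \<in> faces K (Suc j)"
    show "(\<Sum>a\<in>y. if a \<in> \<tau> then 2 * \<gamma> * (?w y * ind \<tau> y) else 0) = 2 * real i * \<gamma> * (?w y * (ind \<tau> y * ind \<tau> y))"
    proof (cases "\<tau> \<subseteq> y")
      case True
      then have "y \<inter> \<tau> = \<tau>" by blast
      then show ?thesis
        using True finite_face[OF wc y] card_faces[OF \<tau>]
        by (simp add: sum.If_cases ind_def flip: Int_def)
    next
      case False
      then have "ind \<tau> y = 0" by (simp add: ind_def)
      then show ?thesis by (simp only: mult_zero_left mult_zero_right if_cancel sum.neutral_const)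
    qed
  qed
  finally show ?thesis by (simp add: inner_faces_def sum_distrib_left)
qed

text \<open>Below the top level the excess is at most \<gamma> and at most the image of the
  indicator under down, so its square is at most \<gamma> times that image, whose mean is the
  measure of the faces containing \<tau>. At the top level \<open>inner_excess_top\<close> compares
  with the indicator at the same level, whose norm does not decrease on going up.\<close>

lemma inner_excess_le:
  assumes ex: "two_sided_local_spectral_expander \<gamma> K" "\<gamma> \<le> 1"
    and \<tau>: "\<tau> \<in> faces K i" "i < cdim K" and j: "j < cdim K"
  shows "inner_faces K j (excess K \<tau> j) (excess K \<tau> j)
    \<le> 2 * real i * \<gamma> * inner_faces K (Suc j) (ind \<tau>) (ind \<tau>)"
proof (cases "i = 0")
  \<comment> \<open>Kept apart because dimension 1 is possible here; the expander condition is then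
    vacuous and \<gamma> may be negative.\<close>
  case True
  then have "\<tau> = {}" using card_faces[OF \<tau>(1)] finite_face[OF wc \<tau>(1)] by simp
  then have "inner_faces K j (excess K \<tau> j) (excess K \<tau> j) = 0"
    unfolding inner_faces_def using excess_contained[OF _ j] by (intro sum.neutral) auto
  then show ?thesis using True by simp
next
  case False
  then have \<gamma>0: "0 \<le> \<gamma>" using expander_nonneg[OF ex(1)] \<tau> by simp
  have ind_sq: "ind \<tau> x * ind \<tau> x = ind \<tau> x" for x by (simp add: ind_def)
  have I0: "0 \<le> inner_faces K (Suc j) (ind \<tau>) (ind \<tau>)" by (rule inner_faces_self_nonneg[OF wc])
  show ?thesis
  proof (cases "j + 2 \<le> cdim K")
    case True
    have "inner_faces K j (excess K \<tau> j) (excess K \<tau> j) \<le> inner_faces K j (\<lambda>_. \<gamma>) (down K j (ind \<tau>))"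
    proof (rule inner_faces_mono[OF wc])
      fix x assume x: "x \<in> faces K j"
      have "excess K \<tau> j x \<le> \<gamma>"
        using expander_step_prob_le[OF ex(1) x True] by (rule excess_le[OF x j \<gamma>0])
      moreover have "excess K \<tau> j x \<le> down K j (ind \<tau>) x" by (simp add: excess_def ind_def)
      ultimately show "excess K \<tau> j x * excess K \<tau> j x \<le> \<gamma> * down K j (ind \<tau>) x"
        using excess_nonneg[OF x j] \<gamma>0 by (intro mult_mono) auto
    qed
    also have "\<dots> = inner_faces K (Suc j) (up K j (\<lambda>_. \<gamma>)) (ind \<tau>)"
      by (rule inner_up_down[OF wc j, symmetric])
    also have "\<dots> = \<gamma> * inner_faces K (Suc j) (ind \<tau>) (ind \<tau>)"
      unfolding inner_faces_def sum_distrib_left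
      by (intro sum.cong refl) (simp add: up_const[OF wc] ind_sq)
    also have "\<dots> \<le> 2 * real i * \<gamma> * inner_faces K (Suc j) (ind \<tau>) (ind \<tau>)"
    proof -
      have "1 * \<gamma> \<le> 2 * real i * \<gamma>" using False \<gamma>0 by (intro mult_right_mono) auto
      then show ?thesis using I0 by (intro mult_right_mono) auto
    qed
    finally show ?thesis .
  next
    case False
    then have d: "cdim K = Suc j" using j by simp
    then obtain j' where j': "j = Suc j'" using \<tau>(2) \<open>i \<noteq> 0\<close> by (cases j) auto
    have "inner_faces K j (excess K \<tau> j) (excess K \<tau> j) \<le> 2 * real i * \<gamma> * inner_faces K j (ind \<tau>) (ind \<tau>)"
      unfolding j' using d j' \<tau> by (intro inner_excess_top[OF ex \<tau>(1)]) auto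
    also have "inner_faces K j (ind \<tau>) (ind \<tau>) \<le> inner_faces K j (down K j (ind \<tau>)) (down K j (ind \<tau>))"
    proof (rule inner_faces_mono[OF wc])
      fix x assume x: "x \<in> faces K j"
      have "ind \<tau> x \<le> down K j (ind \<tau>) x" using excess_nonneg[OF x j, of \<tau>] by (simp add: excess_def)
      then show "ind \<tau> x * ind \<tau> x \<le> down K j (ind \<tau>) x * down K j (ind \<tau>) x"
        by (intro mult_mono) (auto simp: ind_def split: if_splits)
    qed
    also have "\<dots> \<le> inner_faces K (Suc j) (ind \<tau>) (ind \<tau>)" by (rule inner_down_down_le[OF wc j])
    finally show ?thesis using \<gamma>0 by (simp add: mult_left_mono)
  qed
qed

end

section \<open>Pure walks\<close>

definition face_norm :: "wcomplex \<Rightarrow> nat \<Rightarrow> (nat set \<Rightarrow> real) \<Rightarrow> real" where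
  "face_norm K j f = sqrt (inner_faces K j f f)"

lemma up_linear: "up K j (\<lambda>x. c * f x + g x) y = c * up K j f y + up K j g y"
  unfolding up_def sum.distrib sum_distrib_left[symmetric] by (simp add: algebra_simps)

lemma down_linear: "down K j (\<lambda>x. c * f x + g x) x = c * down K j f x + down K j g x"
  by (simp add: down_def distrib_left sum.distrib sum_distrib_left mult.left_commute[of _ c])

lemma up_cong: "(\<And>x. x \<in> faces K j \<Longrightarrow> f x = g x) \<Longrightarrow> up K j f y = up K j g y"
  unfolding up_def by (intro arg_cong[of _ _ "(*) _"] sum.cong) auto

lemma down_cong: "(\<And>y. y \<in> faces K (Suc j) \<Longrightarrow> f y = g y) \<Longrightarrow> down K j f x = down K j g x"
  unfolding down_def by (intro arg_cong[of _ _ "(*) _"] sum.cong) auto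

lemma up_sum: "up K j (\<lambda>x. \<Sum>i\<in>I. F i x) = (\<lambda>y. \<Sum>i\<in>I. up K j (F i) y)"
  by (simp add: up_def fun_eq_iff sum.swap[of _ I] sum_divide_distrib)

lemma down_sum: "down K j (\<lambda>x. \<Sum>i\<in>I. F i x) = (\<lambda>y. \<Sum>i\<in>I. down K j (F i) y)"
  by (simp add: down_def fun_eq_iff sum.swap[of _ I] sum_distrib_left)

lemma pure_walk_op_sum:
  "pure_walk_op K j Y (\<lambda>x. \<Sum>i\<in>I. F i x) s = (\<Sum>i\<in>I. pure_walk_op K j Y (F i) s)"
proof (induction Y arbitrary: j F)
  case (Cons Z Y)
  then show ?case by (cases Z) (simp_all add: up_sum down_sum)
qed simp

text \<open>Elements of \<open>C\<^sub>k\<close> are functions on all sets, so identities that hold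
  only on the faces of a level have to be carried through the remaining steps.\<close>

lemma pure_walk_op_cong:
  assumes "walk_path d k j Y" "\<And>x. x \<in> faces K j \<Longrightarrow> f x = g x" "s \<in> faces K k"
  shows "pure_walk_op K j Y f s = pure_walk_op K j Y g s"
  using assms(1,2)
proof (induction Y arbitrary: j f g)
  case Nil
  then show ?case using assms(3) by simp
next
  case (Cons Z Y)
  show ?case
  proof (cases Z)
    case Up
    then show ?thesis
      using Cons.prems up_cong[of K j f g] by (auto intro!: Cons.IH)
  next
    case Down
    then obtain j' where "j = Suc j'" using Cons.prems(1) by (cases j) auto
    then show ?thesis
      using Down Cons.prems down_cong[of K j' f g] by (auto intro!: Cons.IH)
  qed
qed

lemma pure_walk_op_const:
  assumes "weighted_complex K" "walk_path (cdim K) k j Y" "j \<le> cdim K" "s \<in> faces K k"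
  shows "pure_walk_op K j Y (\<lambda>_. c) s = c"
  using assms(2,3)
proof (induction Y arbitrary: j)
  case (Cons Z Y)
  show ?case
  proof (cases Z)
    case Up
    have "pure_walk_op K (Suc j) Y (up K j (\<lambda>_. c)) s = pure_walk_op K (Suc j) Y (\<lambda>_. c) s"
      using Cons.prems Up assms(4)
      by (intro pure_walk_op_cong[where d = "cdim K" and k = k] up_const[OF assms(1)]) auto
    then show ?thesis using Cons Up by simp
  next
    case Down
    then obtain j' where j': "j = Suc j'" using Cons.prems(1) by (cases j) auto
    have "pure_walk_op K j' Y (down K j' (\<lambda>_. c)) s = pure_walk_op K j' Y (\<lambda>_. c) s"
      using Cons.prems Down assms(4) j'
      by (intro pure_walk_op_cong[where d = "cdim K" and k = k] down_const[OF assms(1)]) auto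
    then show ?thesis using Cons Down j' by simp
  qed
qed simp

section \<open>The product formula for the approximate eigenvalue, step by step\<close>

lemma down_positions_Cons:
  "down_positions (Z # Y) = (if Z = Down then [1] else []) @ map Suc (down_positions Y)"
proof -
  have upt: "[1..<length (Z # Y) + 1] = 1 # map Suc [1..<length Y + 1]"
    by (subst upt_conv_Cons) (simp_all add: map_Suc_upt del: upt_Suc)
  have "filter (\<lambda>j. (Z # Y) ! (j - 1) = Down) (map Suc [1..<length Y + 1]) = map Suc (down_positions Y)"
    unfolding down_positions_def filter_map o_def
    by (intro arg_cong[of _ _ "map Suc"] filter_cong refl) (auto simp: nth_Cons')
  then show ?thesis unfolding down_positions_def[of "Z # Y"] upt by (auto simp del: upt_Suc)
qed

lemma length_down_positions: "length (down_positions Y) = pure_height Y"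
proof (induction Y)
  case Nil
  then show ?case by (simp add: down_positions_def pure_height_def)
next
  case (Cons Z Y)
  then show ?case by (simp add: down_positions_Cons pure_height_def)
qed

lemma pure_eigenvalue_eq:
  "pure_eigenvalue k l Y = (\<Prod>s<pure_height Y.
     1 - real l / max (real l) (real (down_positions Y ! s) - 2 * real (Suc s) + real k + 1))"
  unfolding pure_eigenvalue_def One_nat_def prod.atLeast1_atMost_eq by simp

lemma pure_eigenvalue_Nil: "pure_eigenvalue k l [] = 1"
  by (simp add: pure_eigenvalue_def pure_height_def)

text \<open>Positions drop by one in the tail, and the higher starting level makes up for
  it.\<close>

lemma pure_eigenvalue_Up: "pure_eigenvalue k l (Up # Y) = pure_eigenvalue (Suc k) l Y"
  unfolding pure_eigenvalue_eq
  by (rule prod.cong) (auto simp: pure_height_def down_positions_Cons length_down_positions algebra_simps)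

text \<open>The leading step sits at position 1 and yields the level 1 - 2 + (k + 1) + 1 = k + 1.
  For the later factors position, level and index s all drop by one, which leaves i_s - 2 s + k + 1
  unchanged.\<close>

lemma pure_eigenvalue_Down:
  "pure_eigenvalue (Suc k) l (Down # Y) = level_factor l (Suc k) * pure_eigenvalue k l Y"
proof -
  have h: "pure_height (Down # Y) = Suc (pure_height Y)" by (simp add: pure_height_def)
  have pos: "down_positions (Down # Y) = 1 # map Suc (down_positions Y)"
    by (simp add: down_positions_Cons)
  show ?thesis
    unfolding pure_eigenvalue_eq h pos prod.lessThan_Suc_shift
    by (intro arg_cong2[of _ _ _ _ "(*)"] prod.cong)
       (auto simp: level_factor_def length_down_positions algebra_simps)
qed

text \<open>Each step changes the level by one. For a closed walk the number of up steps is thus the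
  height, which turns the error count into h^2.\<close>

lemma walk_path_counts: "walk_path d k j Y \<Longrightarrow> j + count_list Y Up = k + count_list Y Down"
proof (induction Y arbitrary: j)
  case (Cons Z Y)
  then show ?case
  proof (cases Z)
    case Up
    then show ?thesis using Cons.IH[of "j + 1"] Cons.prems by simp
  next
    case Down
    then obtain l where "j = Suc l" using Cons.prems by (cases j) auto
    then show ?thesis using Cons.IH[of l] Cons.prems Down by simp
  qed
qed simp

section \<open>Norms and the propagation of errors along a walk\<close>

context
  fixes K
  assumes wc: "weighted_complex K"
begin

lemma face_norm_nonneg: "0 \<le> face_norm K j f"
  by (simp add: face_norm_def inner_faces_self_nonneg[OF wc])

lemma face_norm_power2: "(face_norm K j f)\<^sup>2 = inner_faces K j f f"
  by (simp add: face_norm_def inner_faces_self_nonneg[OF wc])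

text \<open>Absorbing the square roots of the weights gives an unweighted norm, to which the
  standard Cauchy-Schwarz and triangle inequalities apply.\<close>

lemma face_norm_L2: "face_norm K j f = L2_set (\<lambda>x. sqrt (face_weight K j x) * f x) (faces K j)"
  unfolding face_norm_def L2_set_def inner_faces_def
  using face_weight_nonneg[OF wc]
  by (intro arg_cong[of _ _ sqrt] sum.cong refl) (simp add: power_mult_distrib power2_eq_square[of "_ :: real"])

lemma abs_inner_le: "\<bar>inner_faces K j f g\<bar> \<le> face_norm K j f * face_norm K j g"
proof -
  have "\<bar>inner_faces K j f g\<bar> \<le> (\<Sum>x\<in>faces K j. \<bar>face_weight K j x * (f x * g x)\<bar>)"
    unfolding inner_faces_def by (rule sum_abs)
  also have "\<dots> = (\<Sum>x\<in>faces K j. \<bar>sqrt (face_weight K j x) * f x\<bar> * \<bar>sqrt (face_weight K j x) * g x\<bar>)"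
    using face_weight_nonneg[OF wc]
    by (intro sum.cong refl) (simp add: abs_mult mult_ac)
  also have "\<dots> \<le> face_norm K j f * face_norm K j g"
    unfolding face_norm_L2 by (rule L2_set_mult_ineq)
  finally show ?thesis .
qed

lemma face_norm_linear_le:
  assumes "0 \<le> c"
  shows "face_norm K j (\<lambda>x. c * f x + g x) \<le> c * face_norm K j f + face_norm K j g"
proof -
  have "face_norm K j (\<lambda>x. c * f x + g x) \<le> face_norm K j (\<lambda>x. c * f x) + face_norm K j g"
    unfolding face_norm_L2 distrib_left by (rule L2_set_triangle_ineq)
  also have "face_norm K j (\<lambda>x. c * f x) = c * face_norm K j f"
    unfolding face_norm_L2 L2_set_right_distrib[OF assms] by (simp add: mult_ac)
  finally show ?thesis .
qed

lemma face_norm_mono: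
  assumes "\<And>x. x \<in> faces K j \<Longrightarrow> 0 \<le> f x" "\<And>x. x \<in> faces K j \<Longrightarrow> f x \<le> g x"
  shows "face_norm K j f \<le> face_norm K j g"
  unfolding face_norm_def real_sqrt_le_iff
  using assms by (intro inner_faces_mono[OF wc] mult_mono) (auto intro: order_trans)

lemma face_norm_scale: "0 \<le> c \<Longrightarrow> face_norm K j (\<lambda>x. c * f x) = c * face_norm K j f"
  unfolding face_norm_L2 by (simp add: L2_set_right_distrib mult_ac)

lemma face_norm_cong: "(\<And>x. x \<in> faces K j \<Longrightarrow> f x = g x) \<Longrightarrow> face_norm K j f = face_norm K j g"
  unfolding face_norm_def by (intro arg_cong[of _ _ sqrt] inner_faces_cong[OF wc]) simp

lemma face_norm_up_le: "j < cdim K \<Longrightarrow> face_norm K (Suc j) (up K j f) \<le> face_norm K j f"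
  unfolding face_norm_def using inner_up_up_le[OF wc] by simp

lemma face_norm_down_le: "j < cdim K \<Longrightarrow> face_norm K j (down K j f) \<le> face_norm K (Suc j) f"
  unfolding face_norm_def using inner_down_down_le[OF wc] by simp

lemma up_nonneg:
  assumes "y \<in> faces K (Suc j)" "\<And>x. x \<in> faces K j \<Longrightarrow> 0 \<le> f x"
  shows "0 \<le> up K j f y"
  using assms(2) by (auto simp: up_def intro!: divide_nonneg_nonneg sum_nonneg)

lemma down_nonneg:
  assumes "x \<in> faces K j" "\<And>y. y \<in> faces K (Suc j) \<Longrightarrow> 0 \<le> f y"
  shows "0 \<le> down K j f x"
  using assms face_weight_nonneg[OF wc]
  by (auto simp: down_def intro!: sum_nonneg mult_nonneg_nonneg divide_nonneg_nonneg)

lemma ind_le_down_ind: "x \<in> faces K j \<Longrightarrow> j < cdim K \<Longrightarrow> ind \<tau> x \<le> down K j (ind \<tau>) x"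
  using excess_nonneg[OF wc, of x j \<tau>] by (simp add: excess_def)

lemma ind_nonneg: "0 \<le> ind \<tau> x"
  by (simp add: ind_def)

text \<open>Converts an error measured by the norm of the indicator at level j into one measured at
  the final level. An up step contributes no factor and cannot decrease that norm, since the
  indicator lies below its image under the contraction down. A down step contributes a
  \<open>level_factor\<close>, and this multiple of the indicator is its image under the contraction
  up.\<close>

lemma pure_eigenvalue_norm_le:
  assumes \<tau>: "finite \<tau>" "card \<tau> = i"
    and "walk_path (cdim K) k j Y" "j \<le> cdim K"
  shows "0 \<le> pure_eigenvalue j i Y \<and>
    pure_eigenvalue j i Y * face_norm K j (ind \<tau>) \<le> face_norm K k (ind \<tau>)"
  using assms(3,4)
proof (induction Y arbitrary: j)
  case Nil
  then show ?case by (simp add: pure_eigenvalue_Nil)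
next
  case (Cons Z Y)
  show ?case
  proof (cases Z)
    case Up
    then have j: "j < cdim K" and path: "walk_path (cdim K) k (Suc j) Y" using Cons.prems by auto
    note IH = Cons.IH[OF path Suc_leI[OF j]]
    have "face_norm K j (ind \<tau>) \<le> face_norm K j (down K j (ind \<tau>))"
      using ind_le_down_ind[OF _ j] ind_nonneg by (intro face_norm_mono) auto
    also have "\<dots> \<le> face_norm K (Suc j) (ind \<tau>)" by (rule face_norm_down_le[OF j])
    finally have "pure_eigenvalue (Suc j) i Y * face_norm K j (ind \<tau>)
        \<le> pure_eigenvalue (Suc j) i Y * face_norm K (Suc j) (ind \<tau>)"
      using IH by (intro mult_left_mono) auto
    then show ?thesis using IH Up by (auto simp: pure_eigenvalue_Up)
  next
    case Down
    then obtain l where l: "j = Suc l" using Cons.prems by (cases j) auto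
    then have path: "walk_path (cdim K) k l Y" and lt: "l < cdim K" using Cons.prems Down by auto
    note IH = Cons.IH[OF path less_imp_le[OF lt]]
    have "level_factor i j * face_norm K j (ind \<tau>) = face_norm K (Suc l) (up K l (ind \<tau>))"
      unfolding l face_norm_scale[OF level_factor_nonneg, symmetric]
      by (rule face_norm_cong) (simp add: up_ind[OF wc _ \<tau>])
    also have "\<dots> \<le> face_norm K l (ind \<tau>)" by (rule face_norm_up_le[OF lt])
    finally have "pure_eigenvalue l i Y * (level_factor i j * face_norm K j (ind \<tau>))
        \<le> pure_eigenvalue l i Y * face_norm K l (ind \<tau>)"
      using IH by (intro mult_left_mono) auto
    then show ?thesis
      using IH Down l level_factor_nonneg[of i j] by (auto simp: pure_eigenvalue_Down mult_ac)
  qed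
qed

text \<open>
  The error term \<open>r\<close> picks up a multiple of the excess at every down step. The excess is
  orthogonal to the indicator of \<open>\<tau>\<close>, so it contributes to the inner product only when paired
  with a previously accumulated error; this makes the deviation quadratic in \<open>\<epsilon>\<close>.
\<close>

lemma inner_pure_walk_op_approx:
  assumes \<tau>: "finite \<tau>" "card \<tau> = i" and \<epsilon>: "0 \<le> \<epsilon>"
    and excess: "\<And>j. j < cdim K \<Longrightarrow> face_norm K j (excess K \<tau> j) \<le> \<epsilon> * face_norm K (Suc j) (ind \<tau>)"
    and path: "walk_path (cdim K) k j Y" "j \<le> cdim K"
    and f: "\<And>x. x \<in> faces K j \<Longrightarrow> f x = c * ind \<tau> x + r x" "0 \<le> c" "\<And>x. x \<in> faces K j \<Longrightarrow> 0 \<le> r x"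
    and norms: "face_norm K j f \<le> B" "face_norm K j r \<le> real n * \<epsilon> * B"
  shows "\<bar>inner_faces K k (ind \<tau>) (pure_walk_op K j Y f) - pure_eigenvalue j i Y * inner_faces K j (ind \<tau>) f\<bar>
    \<le> real (count_list Y Up) * real (n + count_list Y Down) * (\<epsilon>\<^sup>2 * B * face_norm K k (ind \<tau>))"
  using path f norms
\<comment> \<open>n counts the down steps already taken; B bounds the norm of the starting function
  and survives each step because up and down are contractions.\<close>
proof (induction Y arbitrary: j f c r n)
  case Nil
  then show ?case by (simp add: pure_eigenvalue_Nil)
next
  case (Cons Z Y)
  let ?N = "face_norm K k (ind \<tau>)"
  have B: "0 \<le> B" using Cons.prems(6) face_norm_nonneg[of j f] by linarith
  have N: "0 \<le> ?N" by (rule face_norm_nonneg)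
  show ?case
  proof (cases Z)
    case Up
    then have j: "j < cdim K" and path: "walk_path (cdim K) k (Suc j) Y" using Cons.prems by auto
    let ?p = "pure_eigenvalue (Suc j) i Y"
    have p: "0 \<le> ?p" "?p * face_norm K (Suc j) (ind \<tau>) \<le> ?N"
      using pure_eigenvalue_norm_le[OF \<tau> path] j by auto
    have up_f: "up K j f y = c * level_factor i (Suc j) * ind \<tau> y + up K j r y"
      if "y \<in> faces K (Suc j)" for y
    proof -
      have "up K j f y = up K j (\<lambda>x. c * ind \<tau> x + r x) y" using Cons.prems(3) by (rule up_cong)
      then show ?thesis by (simp add: up_linear up_ind[OF wc that \<tau>])
    qed
    have IH: "\<bar>inner_faces K k (ind \<tau>) (pure_walk_op K (Suc j) Y (up K j f)) - ?p * inner_faces K (Suc j) (ind \<tau>) (up K j f)\<bar>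
        \<le> real (count_list Y Up) * real (n + count_list Y Down) * (\<epsilon>\<^sup>2 * B * ?N)"
    proof (rule Cons.IH[OF path Suc_leI[OF j] up_f])
      show "0 \<le> c * level_factor i (Suc j)" using Cons.prems(4) level_factor_nonneg by simp
      show "0 \<le> up K j r y" if "y \<in> faces K (Suc j)" for y
        using that Cons.prems(5) by (rule up_nonneg)
      show "face_norm K (Suc j) (up K j f) \<le> B" "face_norm K (Suc j) (up K j r) \<le> real n * \<epsilon> * B"
        using face_norm_up_le[OF j] Cons.prems(6,7) order_trans by blast+
    qed
    \<comment> \<open>By adjointness the up step acts through the image of the indicator under down,
      that is, indicator plus excess. The excess vanishes on the faces containing \<tau>, so it
      meets only r.\<close>
    have "inner_faces K (Suc j) (ind \<tau>) (up K j f) = inner_faces K (Suc j) (up K j f) (ind \<tau>)"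
      by (simp add: inner_faces_def mult_ac)
    also have "\<dots> = inner_faces K j f (down K j (ind \<tau>))" by (rule inner_up_down[OF wc j])
    also have "\<dots> = inner_faces K j (ind \<tau>) f + inner_faces K j r (excess K \<tau> j)"
      unfolding inner_faces_def sum.distrib[symmetric]
    proof (intro sum.cong refl)
      fix x assume x: "x \<in> faces K j"
      have "f x * down K j (ind \<tau>) x = ind \<tau> x * f x + f x * excess K \<tau> j x"
        by (simp add: excess_def algebra_simps)
      also have "f x * excess K \<tau> j x = c * (ind \<tau> x * excess K \<tau> j x) + r x * excess K \<tau> j x"
        by (simp add: Cons.prems(3)[OF x] algebra_simps)
      finally show "face_weight K j x * (f x * down K j (ind \<tau>) x) =
          face_weight K j x * (ind \<tau> x * f x) + face_weight K j x * (r x * excess K \<tau> j x)"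
        by (simp add: ind_excess[OF wc x j] algebra_simps)
    qed
    finally have eq: "inner_faces K (Suc j) (ind \<tau>) (up K j f) =
        inner_faces K j (ind \<tau>) f + inner_faces K j r (excess K \<tau> j)" .
    have "\<bar>?p * inner_faces K j r (excess K \<tau> j)\<bar> \<le> ?p * (face_norm K j r * face_norm K j (excess K \<tau> j))"
      using p abs_inner_le by (simp add: abs_mult mult_left_mono)
    also have "\<dots> \<le> ?p * ((real n * \<epsilon> * B) * (\<epsilon> * face_norm K (Suc j) (ind \<tau>)))"
      using p B \<epsilon> Cons.prems(7) excess[OF j] face_norm_nonneg
      by (intro mult_left_mono mult_mono) auto
    also have "\<dots> = real n * \<epsilon>\<^sup>2 * B * (?p * face_norm K (Suc j) (ind \<tau>))"
      by (simp add: power2_eq_square)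
    \<comment> \<open>Here the eigenvalue of the remaining steps absorbs the norm at level j +
      1.\<close>
    also have "\<dots> \<le> real n * \<epsilon>\<^sup>2 * B * ?N"
      using p B by (intro mult_left_mono) auto
    also have "\<dots> \<le> real (n + count_list Y Down) * (\<epsilon>\<^sup>2 * B * ?N)"
    proof -
      have "real n * (\<epsilon>\<^sup>2 * B * ?N) \<le> real (n + count_list Y Down) * (\<epsilon>\<^sup>2 * B * ?N)"
        using B N by (intro mult_right_mono) auto
      then show ?thesis by (simp add: mult_ac)
    qed
    finally have err: "\<bar>?p * inner_faces K j r (excess K \<tau> j)\<bar> \<le> real (n + count_list Y Down) * (\<epsilon>\<^sup>2 * B * ?N)" .
    show ?thesis
      using IH err Up unfolding eq
      by (simp add: pure_eigenvalue_Up algebra_simps abs_le_iff)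
  next
    case Down
    then obtain l where l: "j = Suc l" using Cons.prems by (cases j) auto
    then have path: "walk_path (cdim K) k l Y" and lt: "l < cdim K" using Cons.prems Down by auto
    have down_f: "down K l f x = c * ind \<tau> x + (c * excess K \<tau> l x + down K l r x)" for x
    proof -
      have "down K l f x = down K l (\<lambda>x. c * ind \<tau> x + r x) x"
        using Cons.prems(3) unfolding l by (rule down_cong)
      then show ?thesis unfolding down_linear by (simp add: excess_def algebra_simps)
    qed
    \<comment> \<open>Since r is nonnegative, c times the indicator lies below f and inherits the
      bound B. This is why the sign of r is carried along.\<close>
    have c_ind: "c * face_norm K j (ind \<tau>) \<le> B"
    proof -
      have "c * face_norm K j (ind \<tau>) \<le> face_norm K j f"
        unfolding face_norm_scale[OF Cons.prems(4), symmetric]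
        using Cons.prems(3-5) ind_nonneg by (intro face_norm_mono) auto
      then show ?thesis using Cons.prems(6) by linarith
    qed
    have IH: "\<bar>inner_faces K k (ind \<tau>) (pure_walk_op K l Y (down K l f)) - pure_eigenvalue l i Y * inner_faces K l (ind \<tau>) (down K l f)\<bar>
        \<le> real (count_list Y Up) * real (Suc n + count_list Y Down) * (\<epsilon>\<^sup>2 * B * ?N)"
    proof (rule Cons.IH[OF path less_imp_le[OF lt] down_f Cons.prems(4)])
      show "0 \<le> c * excess K \<tau> l x + down K l r x" if "x \<in> faces K l" for x
        using Cons.prems(4) excess_nonneg[OF wc that lt] down_nonneg[OF that] Cons.prems(5) l by simp
      show "face_norm K l (down K l f) \<le> B"
        using face_norm_down_le[OF lt] Cons.prems(6) l order_trans by blast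
      have "face_norm K l (\<lambda>x. c * excess K \<tau> l x + down K l r x)
          \<le> c * face_norm K l (excess K \<tau> l) + face_norm K l (down K l r)"
        by (rule face_norm_linear_le[OF Cons.prems(4)])
      also have "\<dots> \<le> c * (\<epsilon> * face_norm K j (ind \<tau>)) + face_norm K j r"
        using excess[OF lt] Cons.prems(4) face_norm_down_le[OF lt, of r] l
        by (intro add_mono mult_left_mono) auto
      \<comment> \<open>The new excess adds one \<epsilon> B to the error, hence
        \<open>Suc n\<close>.\<close>
      also have "\<dots> \<le> \<epsilon> * B + real n * \<epsilon> * B"
        using mult_left_mono[OF c_ind \<epsilon>] Cons.prems(7) by (simp add: mult_ac)
      finally show "face_norm K l (\<lambda>x. c * excess K \<tau> l x + down K l r x) \<le> real (Suc n) * \<epsilon> * B"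
        by (simp add: algebra_simps)
    qed
    \<comment> \<open>A down step is exact: dually, it is an up step applied to the
      indicator.\<close>
    have "inner_faces K l (ind \<tau>) (down K l f) = inner_faces K j (up K l (ind \<tau>)) f"
      unfolding l by (rule inner_up_down[OF wc lt, symmetric])
    also have "\<dots> = level_factor i j * inner_faces K j (ind \<tau>) f"
      unfolding l inner_faces_def sum_distrib_left
      by (intro sum.cong refl) (simp add: up_ind[OF wc _ \<tau>] mult_ac)
    finally show ?thesis
      using IH Down l by (simp add: pure_eigenvalue_Down mult_ac)
  qed
qed

end

section \<open>Expansion of links\<close>

lemma sum_transition:
  assumes "finite S"
  shows "(\<Sum>y\<in>S. transition K k \<alpha> v y) = walk_op K k \<alpha> (\<lambda>x. if x \<in> S then 1 else 0) v"
proof -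
  have ind: "(\<lambda>x. \<Sum>y\<in>S. if x = y then 1 else 0) = (\<lambda>x. if x \<in> S then 1 else 0 :: real)"
    using assms by (simp add: fun_eq_iff)
  have "(\<Sum>y\<in>S. transition K k \<alpha> v y) =
      (\<Sum>Y\<in>{Y. \<alpha> Y \<noteq> 0}. \<alpha> Y * (\<Sum>y\<in>S. pure_walk_op K k Y (\<lambda>x. if x = y then 1 else 0) v))"
    unfolding transition_def walk_op_def sum_distrib_left by (rule sum.swap)
  then show ?thesis
    unfolding pure_walk_op_sum[symmetric] ind walk_op_def .
qed

context
  fixes K k \<alpha>
  assumes wc: "weighted_complex K" and hd: "hd_walk K k \<alpha>" and k: "k \<le> cdim K"
begin

lemma walk_path_support: "\<alpha> Y \<noteq> 0 \<Longrightarrow> walk_path (cdim K) k k Y"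
  using hd by (simp add: hd_walk_def pure_walk_def)

lemma walk_op_cong:
  assumes "\<And>x. x \<in> faces K k \<Longrightarrow> f x = g x" "v \<in> faces K k"
  shows "walk_op K k \<alpha> f v = walk_op K k \<alpha> g v"
  unfolding walk_op_def
  using pure_walk_op_cong[OF walk_path_support assms] by (intro sum.cong) auto

text \<open>Pure walks fix constants and the coefficients sum to 1; this makes the transition
  probabilities out of each face sum to 1.\<close>

lemma walk_op_const:
  assumes "v \<in> faces K k"
  shows "walk_op K k \<alpha> (\<lambda>_. c) v = c"
proof -
  have "walk_op K k \<alpha> (\<lambda>_. c) v = (\<Sum>Y\<in>{Y. \<alpha> Y \<noteq> 0}. \<alpha> Y) * c"
    unfolding walk_op_def sum_distrib_right
    using pure_walk_op_const[OF wc walk_path_support k assms] by (intro sum.cong) auto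
  then show ?thesis using hd by (simp add: hd_walk_def)
qed

lemma sum_transition_complement:
  assumes "S \<subseteq> faces K k" "v \<in> faces K k"
  shows "(\<Sum>y\<in>faces K k - S. transition K k \<alpha> v y) = 1 - walk_op K k \<alpha> (\<lambda>x. if x \<in> S then 1 else 0) v"
proof -
  have fin: "finite (faces K k)" by (rule finite_faces[OF wc])
  have "(\<Sum>y\<in>faces K k. transition K k \<alpha> v y) = walk_op K k \<alpha> (\<lambda>_. 1) v"
    unfolding sum_transition[OF fin] using assms(2) by (intro walk_op_cong) auto
  then have "(\<Sum>y\<in>faces K k. transition K k \<alpha> v y) = 1"
    using walk_op_const[OF assms(2)] by simp
  then show ?thesis
    using sum_transition[OF finite_subset[OF assms(1) fin], of K k \<alpha> v] fin assms(1)
    by (simp add: sum_diff)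
qed

lemma expansion_faces_containing:
  assumes "faces_containing K k \<tau> \<noteq> {}"
  shows "0 < inner_faces K k (ind \<tau>) (ind \<tau>)"
    and "expansion K k \<alpha> (faces_containing K k \<tau>) =
      1 - inner_faces K k (ind \<tau>) (walk_op K k \<alpha> (ind \<tau>)) / inner_faces K k (ind \<tau>) (ind \<tau>)"
proof -
  let ?S = "faces_containing K k \<tau>" and ?Z = "inner_faces K k (ind \<tau>) (ind \<tau>)"
  have S: "?S \<subseteq> faces K k" by (auto simp: faces_containing_def)
  have fin: "finite (faces K k)" by (rule finite_faces[OF wc])
  have restrict: "inner_faces K k (ind \<tau>) h = (\<Sum>v\<in>?S. face_weight K k v * h v)" for h
    unfolding inner_faces_def using fin S
    by (intro sum.mono_neutral_cong_right) (auto simp: ind_def faces_containing_def)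
  have Z: "?Z = (\<Sum>v\<in>?S. face_weight K k v)"
    unfolding restrict by (intro sum.cong refl) (simp add: ind_def faces_containing_def)
  show pos: "0 < ?Z"
    unfolding Z using assms finite_subset[OF S fin] S
    by (intro sum_pos) (auto intro: face_weight_pos[OF wc])
  have "expansion K k \<alpha> ?S = (\<Sum>v\<in>?S. face_weight K k v / ?Z * (1 - walk_op K k \<alpha> (ind \<tau>) v))"
    unfolding expansion_def Z
  proof (intro sum.cong refl)
    fix v assume v: "v \<in> ?S"
    have "walk_op K k \<alpha> (\<lambda>x. if x \<in> ?S then 1 else 0) v = walk_op K k \<alpha> (ind \<tau>) v"
      using v S by (intro walk_op_cong) (auto simp: ind_def faces_containing_def)
    then show "face_weight K k v / (\<Sum>x\<in>?S. face_weight K k x) * (\<Sum>y\<in>faces K k - ?S. transition K k \<alpha> v y) =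
        face_weight K k v / (\<Sum>x\<in>?S. face_weight K k x) * (1 - walk_op K k \<alpha> (ind \<tau>) v)"
      using v S by (simp add: sum_transition_complement[OF S] subset_iff)
  qed
  also have "\<dots> = (\<Sum>v\<in>?S. face_weight K k v) / ?Z - (\<Sum>v\<in>?S. face_weight K k v * walk_op K k \<alpha> (ind \<tau>) v) / ?Z"
    unfolding sum_divide_distrib sum_subtractf[symmetric]
    by (intro sum.cong refl) (simp add: algebra_simps diff_divide_distrib)
  also have "\<dots> = 1 - inner_faces K k (ind \<tau>) (walk_op K k \<alpha> (ind \<tau>)) / ?Z"
    using pos by (simp add: restrict[of "walk_op K k \<alpha> (ind \<tau>)"] flip: Z)
  finally show "expansion K k \<alpha> ?S = 1 - inner_faces K k (ind \<tau>) (walk_op K k \<alpha> (ind \<tau>)) / ?Z" .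
qed

lemma inner_walk_op:
  "inner_faces K k g (walk_op K k \<alpha> f) = (\<Sum>Y\<in>{Y. \<alpha> Y \<noteq> 0}. \<alpha> Y * inner_faces K k g (pure_walk_op K k Y f))"
proof -
  have "inner_faces K k g (walk_op K k \<alpha> f) =
      (\<Sum>x\<in>faces K k. \<Sum>Y\<in>{Y. \<alpha> Y \<noteq> 0}. \<alpha> Y * (face_weight K k x * (g x * pure_walk_op K k Y f x)))"
    unfolding inner_faces_def walk_op_def sum_distrib_left by (intro sum.cong refl) (simp add: mult_ac)
  then show ?thesis
    unfolding inner_faces_def sum_distrib_left by (subst sum.swap)
qed

text \<open>Errors of different pure walks need not cancel, so they add up with the absolute values
  of the coefficients, giving \<open>walk_weight\<close>. The factor i of the excess bound is
  enlarged to k so that the constant serves every \<tau>.\<close>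

lemma expansion_faces_containing_approx:
  assumes ex: "two_sided_local_spectral_expander \<gamma> K" "\<gamma> \<le> 1"
    and kd: "k < cdim K" and i: "i \<le> k" and \<tau>: "\<tau> \<in> faces K i"
  shows "\<bar>expansion K k \<alpha> (faces_containing K k \<tau>) - (1 - walk_eigenvalue k i \<alpha>)\<bar>
    \<le> walk_weight \<alpha> * real (walk_height \<alpha>) ^ 2 * (2 * real k) * \<gamma>"
proof -
  let ?A = "{Y. \<alpha> Y \<noteq> 0}" and ?Z = "inner_faces K k (ind \<tau>) (ind \<tau>)"
  have fin: "finite ?A" using hd by (simp add: hd_walk_def)
  have \<tau>': "finite \<tau>" "card \<tau> = i" using finite_face[OF wc \<tau>] card_faces[OF \<tau>] by auto
  \<comment> \<open>For k = 0 the dimension may be 1 and \<gamma> negative, but then the product is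
    0.\<close>
  have \<gamma>0: "0 \<le> 2 * real k * \<gamma>"
    using expander_nonneg[OF wc ex(1)] kd by (cases "k = 0") auto
  define \<epsilon> where "\<epsilon> = sqrt (2 * real k * \<gamma>)"
  have \<epsilon>: "0 \<le> \<epsilon>" "\<epsilon>\<^sup>2 = 2 * real k * \<gamma>" using \<gamma>0 by (auto simp: \<epsilon>_def)
  have excess: "face_norm K j (excess K \<tau> j) \<le> \<epsilon> * face_norm K (Suc j) (ind \<tau>)" if j: "j < cdim K" for j
  proof -
    have "inner_faces K j (excess K \<tau> j) (excess K \<tau> j)
        \<le> 2 * real i * \<gamma> * inner_faces K (Suc j) (ind \<tau>) (ind \<tau>)"
      using i kd by (intro inner_excess_le[OF wc ex \<tau> _ j]) auto
    also have "\<dots> \<le> 2 * real k * \<gamma> * inner_faces K (Suc j) (ind \<tau>) (ind \<tau>)"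
    proof -
      have "2 * real i * \<gamma> \<le> 2 * real k * \<gamma>"
        using i \<gamma>0 by (cases "k = 0") (auto simp: zero_le_mult_iff mult_right_mono)
      then show ?thesis by (rule mult_right_mono[OF _ inner_faces_self_nonneg[OF wc]])
    qed
    finally show ?thesis
      unfolding face_norm_def \<epsilon>_def real_sqrt_mult[symmetric] by (rule real_sqrt_le_mono)
  qed
  obtain t where t: "t \<in> facets K" "\<tau> \<subseteq> t" using \<tau> by (auto simp: faces_def)
  have "\<exists>x. \<tau> \<subseteq> x \<and> x \<subseteq> t \<and> card x = k"
    using i kd t facet_finite_card[OF wc t(1)] \<tau>' by (intro exists_subset_between) auto
  then have "faces_containing K k \<tau> \<noteq> {}"
    using t by (auto simp: faces_containing_def faces_def)
  note Z = expansion_faces_containing[OF this]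
  have walk: "\<bar>inner_faces K k (ind \<tau>) (pure_walk_op K k Y (ind \<tau>)) - pure_eigenvalue k i Y * ?Z\<bar>
      \<le> real (walk_height \<alpha>) ^ 2 * (2 * real k * \<gamma>) * ?Z" if Y: "Y \<in> ?A" for Y
  proof -
    have path: "walk_path (cdim K) k k Y" using Y walk_path_support by simp
    have counts: "count_list Y Up = pure_height Y" "count_list Y Down = pure_height Y"
      using walk_path_counts[OF path] by (auto simp: pure_height_def)
    have "pure_height Y \<le> walk_height \<alpha>"
      unfolding walk_height_def
    proof (rule Max_ge)
      show "finite {pure_height Y | Y. \<alpha> Y \<noteq> 0}"
        using finite_imageI[OF fin, of pure_height] by (simp add: image_Collect)
    qed (use Y in auto)
    then have "real (pure_height Y) ^ 2 \<le> real (walk_height \<alpha>) ^ 2" by (intro power_mono) auto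
    have zero: "face_norm K k (\<lambda>_. 0) = 0" by (simp add: face_norm_def inner_faces_def)
    have "\<bar>inner_faces K k (ind \<tau>) (pure_walk_op K k Y (ind \<tau>)) - pure_eigenvalue k i Y * ?Z\<bar>
      \<le> real (count_list Y Up) * real (0 + count_list Y Down) *
        (\<epsilon>\<^sup>2 * face_norm K k (ind \<tau>) * face_norm K k (ind \<tau>))"
      \<comment> \<open>No initial error: r = 0 and n = 0. B is the norm of the indicator itself, so
        B times the final norm is the measure of the set.\<close>
      by (rule inner_pure_walk_op_approx[OF wc \<tau>' \<epsilon>(1) excess path k, where c = 1 and r = "\<lambda>_. 0"])
         (auto simp: zero)
    also have "\<dots> = real (pure_height Y) ^ 2 * ((2 * real k * \<gamma>) * ?Z)"
      unfolding \<epsilon>(2) counts by (simp add: face_norm_power2[OF wc, symmetric] power2_eq_square)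
    also have "\<dots> \<le> real (walk_height \<alpha>) ^ 2 * ((2 * real k * \<gamma>) * ?Z)"
      by (rule mult_right_mono[OF \<open>real (pure_height Y) ^ 2 \<le> _\<close> mult_nonneg_nonneg[OF \<gamma>0 less_imp_le[OF Z(1)]]])
    finally show ?thesis by (simp add: mult_ac)
  qed
  have "\<bar>walk_eigenvalue k i \<alpha> * ?Z - inner_faces K k (ind \<tau>) (walk_op K k \<alpha> (ind \<tau>))\<bar>
      = \<bar>\<Sum>Y\<in>?A. \<alpha> Y * (pure_eigenvalue k i Y * ?Z - inner_faces K k (ind \<tau>) (pure_walk_op K k Y (ind \<tau>)))\<bar>"
    unfolding inner_walk_op walk_eigenvalue_def sum_distrib_right sum_subtractf[symmetric]
    by (intro arg_cong[of _ _ abs] sum.cong refl) (simp add: algebra_simps)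
  also have "\<dots> \<le> (\<Sum>Y\<in>?A. \<bar>\<alpha> Y\<bar> * (real (walk_height \<alpha>) ^ 2 * (2 * real k * \<gamma>) * ?Z))"
  proof (intro order_trans[OF sum_abs] sum_mono)
    fix Y assume "Y \<in> ?A"
    from mult_left_mono[OF walk[OF this] abs_ge_zero[of "\<alpha> Y"]]
    show "\<bar>\<alpha> Y * (pure_eigenvalue k i Y * ?Z - inner_faces K k (ind \<tau>) (pure_walk_op K k Y (ind \<tau>)))\<bar>
        \<le> \<bar>\<alpha> Y\<bar> * (real (walk_height \<alpha>) ^ 2 * (2 * real k * \<gamma>) * ?Z)"
      by (simp only: abs_mult abs_minus_commute)
  qed
  also have "\<dots> = walk_weight \<alpha> * real (walk_height \<alpha>) ^ 2 * (2 * real k) * \<gamma> * ?Z"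
    unfolding walk_weight_def sum_distrib_right[symmetric] by simp
  finally have main: "\<bar>walk_eigenvalue k i \<alpha> * ?Z - inner_faces K k (ind \<tau>) (walk_op K k \<alpha> (ind \<tau>))\<bar>
      \<le> walk_weight \<alpha> * real (walk_height \<alpha>) ^ 2 * (2 * real k) * \<gamma> * ?Z" .
  have "expansion K k \<alpha> (faces_containing K k \<tau>) - (1 - walk_eigenvalue k i \<alpha>) =
      (walk_eigenvalue k i \<alpha> * ?Z - inner_faces K k (ind \<tau>) (walk_op K k \<alpha> (ind \<tau>))) / ?Z"
    using Z(1) by (simp add: Z(2) diff_divide_distrib)
  then show ?thesis using main Z(1) by (simp add: pos_divide_le_eq)
qed

end

theorem theorem9p2:
  "\<exists>C\<^sub>0::real. \<exists>C\<^sub>1::real. C\<^sub>0 > 0 \<and> C\<^sub>1 > 0 \<and>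
     (\<forall>(K::wcomplex) (\<gamma>::real) (k::nat) (\<alpha>::step list \<Rightarrow> real).
        weighted_complex K \<longrightarrow>
        two_sided_local_spectral_expander \<gamma> K \<longrightarrow>
        \<gamma> \<le> 2 powr (- C\<^sub>0 * real k) \<longrightarrow>
        k < cdim K \<longrightarrow>
        hd_walk K k \<alpha> \<longrightarrow>
        complete_walk k \<alpha> \<longrightarrow>
        (\<exists>c::real. 0 \<le> c \<and>
           c \<le> walk_weight \<alpha> * real (walk_height \<alpha>) ^ 2 * 2 powr (C\<^sub>1 * real k) \<and>
           (\<forall>i\<le>k. \<forall>\<tau>\<in>faces K i.
              \<bar>expansion K k \<alpha> (faces_containing K k \<tau>) - (1 - walk_eigenvalue k i \<alpha>)\<bar>
                \<le> c * \<gamma>)))"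
\<comment> \<open>\<open>C\<^sub>0\<close> = 1 and \<open>C\<^sub>1\<close> = 2. The bound on
  \<gamma> enters as \<gamma> <= 1, which gives \<gamma>^2 <= \<gamma> in the link estimate, and the
  factor 2 k is absorbed by 2^(2 k).\<close>
proof (rule exI[of _ 1], rule exI[of _ 2], intro conjI allI impI)
  fix K \<gamma> k \<alpha>
  assume wc: "weighted_complex K" and ex: "two_sided_local_spectral_expander \<gamma> K"
    and \<gamma>: "\<gamma> \<le> 2 powr (- 1 * real k)" and k: "k < cdim K" and hd: "hd_walk K k \<alpha>"
  let ?c = "walk_weight \<alpha> * real (walk_height \<alpha>) ^ 2 * (2 * real k)"
  have "2 powr (- 1 * real k) \<le> (2::real) powr 0" by (intro powr_mono) auto
  then have \<gamma>1: "\<gamma> \<le> 1" using \<gamma> by simp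
  have w: "0 \<le> walk_weight \<alpha>" by (auto simp: walk_weight_def intro: sum_nonneg)
  have "2 * real k \<le> 2 powr (2 * real k)"
  proof -
    have "2 * k < 2 ^ (2 * k)" by (rule less_exp)
    then have "real (2 * k) < real (2 ^ (2 * k))" by (simp only: of_nat_less_iff)
    then show ?thesis by (simp flip: powr_realpow)
  qed
  then have "?c \<le> walk_weight \<alpha> * real (walk_height \<alpha>) ^ 2 * 2 powr (2 * real k)"
    using w by (intro mult_left_mono) auto
  moreover have "0 \<le> ?c" using w by simp
  moreover have "\<bar>expansion K k \<alpha> (faces_containing K k \<tau>) - (1 - walk_eigenvalue k i \<alpha>)\<bar> \<le> ?c * \<gamma>"
    if "i \<le> k" "\<tau> \<in> faces K i" for i \<tau>
    by (rule expansion_faces_containing_approx[OF wc hd less_imp_le[OF k] ex \<gamma>1 k that])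
  ultimately show "\<exists>c::real. 0 \<le> c \<and>
      c \<le> walk_weight \<alpha> * real (walk_height \<alpha>) ^ 2 * 2 powr (2 * real k) \<and>
      (\<forall>i\<le>k. \<forall>\<tau>\<in>faces K i.
        \<bar>expansion K k \<alpha> (faces_containing K k \<tau>) - (1 - walk_eigenvalue k i \<alpha>)\<bar> \<le> c * \<gamma>)"
    by blast
qed auto

end
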